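(* Let $n\geq 1$, $\nu\geq 1$, let $0\leq a_1,b_1,a_2<n$, and let $P=P_n(x_0x_{a_1}^{-1}x_{a_1+b_1}x_{a_1+b_1+a_2}^{-1})$ (subscripts mod $n$) be an irreducible and non-redundant cyclic presentation, and let $G$ be the group defined by $P$. Then $P$ is $(2,4,\nu)$-special if and only if $n=8$, $\nu=2$ and one of the following holds: (a) ($a_2\equiv 5a_1$, $b_1\equiv 3a_1$ mod $n$) or ($a_2\equiv 5a_1$, $b_1\equiv 7a_1$ mod $n$), in which case $G\cong G_8(x_0x_1x_4x_1)$; (b) ($a_2\equiv 3a_1$, $b_1\equiv 5a_1$ mod $n$) or ($a_2\equiv 3a_1$, $b_1\equiv 7a_1$ mod $n$), in which case $G\cong G_8(x_0x_1x_6x_1)$; (c) ($a_2\equiv 3a_1$, $b_1\equiv a_1$ mod $n$) or ($a_2\equiv 3a_1$, $b_1\equiv 3a_1$ mod $n$), in which case $G\cong G_8(x_0x_1x_4x_3)$.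
   Context: Cyclic presentations: $F_n$ is the free group with basis $x_0,\ldots,x_{n-1}$ and $\theta:F_n\to F_n$ is the automorphism $\theta(x_i)=x_{i+1}$ (subscripts mod $n$). For a cyclically reduced word $w\in F_n$ (cyclic reducedness of the defining word is part of the definition), $P_n(w)=\langle x_0,\ldots,x_{n-1}\mid w,\theta(w),\ldots,\theta^{n-1}(w)\rangle$ and $G_n(w)$ is the group it defines. $P_n(w)$ is irreducible if the greatest common divisor of $n$ and the subscripts of the generators appearing in $w$ is $1$. Non-redundant: a relator $r\in R$ of $\langle X\mid R\rangle$ is freely redundant if it is freely trivial or there is $s\in R$ such that $r,s$ are distinct elements of the free group on $X$ and $r$ is freely conjugate to $s$ or to $s^{-1}$. A presentation is non-redundant if it contains no freely redundant relator. Star graph: let $\tilde R$ be the set of all cyclic permutations of elements of $R\cup R^{-1}$. The star graph of $\langle X\mid R\rangle$ (all relators cyclically reduced) is the undirected graph, possibly with multiple edges, with vertex set $X\cup X^{-1}$ and an edge joining $x$ and $y$ for each distinct word of the form $xy^{-1}u$ in $\tilde R$, where the edges corresponding to the inverse pair $xy^{-1}u$, $yx^{-1}u^{-1}$ are identified. Special presentations: let $m\geq 2$, $k\geq 3$, $\nu\geq 1$. A finite presentation $\langle X\mid R\rangle$ is $(m,k,\nu)$-special if (a) its star graph has exactly $\nu$ connected components, which are pairwise isomorphic, each a connected bipartite graph of diameter $m$ and girth $2m$ in which each vertex has degree at least $3$; (b) each relator has length $k$; (c) if $m=2$ then $k\geq 4$. Girth is the length of a shortest closed path in which consecutive edges are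 never equal (so a pair of parallel edges gives such a path of length $2$). *)

theory Defs
  imports
    "HOL-Algebra.Coset"
    "HOL-Library.Extended_Nat"
    "HOL-Number_Theory.Cong"
begin

section \<open>Free groups and group presentations\<close>

text \<open>The letter \<open>Gen x\<close> stands for the generator \<open>x\<close>, and \<open>Inv x\<close> for its formal inverse.\<close>

datatype 'x letter = Gen 'x | Inv 'x

type_synonym 'x word = "'x letter list"

fun letter_inv :: "'x letter \<Rightarrow> 'x letter" where
  "letter_inv (Gen x) = Inv x"
| "letter_inv (Inv x) = Gen x"

definition word_inv :: "'x word \<Rightarrow> 'x word" where
  "word_inv w = rev (map letter_inv w)"

definition letters :: "'x set \<Rightarrow> 'x letter set" where
  "letters X = Gen ` X \<union> Inv ` X"

definition reduced :: "'x word \<Rightarrow> bool" where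
  "reduced w \<longleftrightarrow> successively (\<lambda>a b. b \<noteq> letter_inv a) w"

definition cyclically_reduced :: "'x word \<Rightarrow> bool" where
  "cyclically_reduced w \<longleftrightarrow> reduced w \<and> (w \<noteq> [] \<longrightarrow> hd w \<noteq> letter_inv (last w))"

fun cancel_cons :: "'x letter \<Rightarrow> 'x word \<Rightarrow> 'x word" where
  "cancel_cons a [] = [a]"
| "cancel_cons a (b # w) = (if b = letter_inv a then w else a # b # w)"

definition free_reduce :: "'x word \<Rightarrow> 'x word" where
  "free_reduce w = foldr cancel_cons w []"

text \<open>Elements of the free group on \<open>X\<close> are represented by their unique reduced words.\<close>

definition free_group :: "'x set \<Rightarrow> 'x word monoid" where
  "free_group X =
     \<lparr>carrier = {w. reduced w \<and> set w \<subseteq> letters X},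
      monoid.mult = (\<lambda>u v. free_reduce (u @ v)),
      one = []\<rparr>"

lemma letter_inv_letter_inv [simp]: "letter_inv (letter_inv a) = a"
  by (cases a) auto

lemma reduced_Cons: "reduced (a # w) \<longleftrightarrow> reduced w \<and> (w \<noteq> [] \<longrightarrow> hd w \<noteq> letter_inv a)"
  by (cases w) (auto simp: reduced_def)

lemma reduced_cancel_cons: "reduced w \<Longrightarrow> reduced (cancel_cons a w)"
  by (cases w) (auto simp: reduced_Cons)

lemma set_cancel_cons: "set (cancel_cons a w) \<subseteq> insert a (set w)"
  by (cases w) auto

lemma cancel_cons_inv: "reduced w \<Longrightarrow> cancel_cons a (cancel_cons (letter_inv a) w) = w"
proof (cases w)
  case (Cons b v)
  assume "reduced w"
  with Cons show ?thesis by (cases v) (auto simp: reduced_Cons)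
qed simp

lemma reduced_foldr: "reduced w \<Longrightarrow> reduced (foldr cancel_cons u w)"
  by (induction u) (auto simp: reduced_cancel_cons)

lemma set_foldr: "set (foldr cancel_cons u w) \<subseteq> set u \<union> set w"
  using set_cancel_cons by (induction u) fastforce+

lemma foldr_reduced: "reduced w \<Longrightarrow> foldr cancel_cons w [] = w"
proof (induction w)
  case (Cons a w)
  then show ?case by (cases w) (auto simp: reduced_Cons)
qed simp

lemma foldr_cancel_cons:
  assumes "reduced w"
  shows "foldr cancel_cons (cancel_cons a z) w = cancel_cons a (foldr cancel_cons z w)"
proof (cases z)
  case (Cons b v)
  then show ?thesis
    using cancel_cons_inv[OF reduced_foldr[OF assms], of a v] by auto
qed simp

lemma foldr_foldr:
  "reduced w \<Longrightarrow> foldr cancel_cons (foldr cancel_cons u v) w = foldr cancel_cons u (foldr cancel_cons v w)"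
  by (induction u) (auto simp: foldr_cancel_cons)

lemma free_reduce_append: "reduced v \<Longrightarrow> free_reduce (u @ v) = foldr cancel_cons u v"
  by (simp add: free_reduce_def foldr_reduced)

lemma word_inv_Cons: "word_inv (a # w) = word_inv w @ [letter_inv a]"
  by (simp add: word_inv_def)

lemma reduced_word_inv [simp]: "reduced (word_inv w) \<longleftrightarrow> reduced w"
proof -
  have "(a \<noteq> letter_inv (letter_inv b)) = (letter_inv b \<noteq> letter_inv (letter_inv (letter_inv a)))"
    for a b :: "'a letter"
    by (metis letter_inv_letter_inv)
  moreover have "letter_inv x = letter_inv y \<longleftrightarrow> x = y" for x y :: "'a letter"
    by (metis letter_inv_letter_inv)
  ultimately show ?thesis
    unfolding reduced_def word_inv_def successively_rev successively_map
    by (auto intro!: arg_cong2[where f = successively] ext)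
qed

lemma foldr_word_inv: "reduced v \<Longrightarrow> foldr cancel_cons (word_inv w) (foldr cancel_cons w v) = v"
proof (induction w arbitrary: v)
  case (Cons a w)
  then show ?case
    using cancel_cons_inv[of "foldr cancel_cons w v" "letter_inv a"]
    by (simp add: word_inv_Cons reduced_foldr)
qed (simp add: word_inv_def)

lemma set_word_inv: "set w \<subseteq> letters X \<Longrightarrow> set (word_inv w) \<subseteq> letters X"
  by (auto simp: word_inv_def letters_def)

lemma free_group_inverse:
  assumes "w \<in> carrier (free_group X)"
  shows "word_inv w \<in> carrier (free_group X)"
    and "word_inv w \<otimes>\<^bsub>free_group X\<^esub> w = \<one>\<^bsub>free_group X\<^esub>"
proof -
  show "word_inv w \<in> carrier (free_group X)"
    using assms by (auto simp: free_group_def dest: set_word_inv)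
  show "word_inv w \<otimes>\<^bsub>free_group X\<^esub> w = \<one>\<^bsub>free_group X\<^esub>"
    using assms foldr_word_inv[of "[]" w]
    by (auto simp: free_group_def free_reduce_append foldr_reduced reduced_def)
qed

lemma group_free_group: "group (free_group X)"
proof (rule groupI)
  fix u v assume "u \<in> carrier (free_group X)" "v \<in> carrier (free_group X)"
  then show "u \<otimes>\<^bsub>free_group X\<^esub> v \<in> carrier (free_group X)"
    using set_foldr[of u v] by (auto simp: free_group_def free_reduce_append reduced_foldr)
next
  fix u v w
  assume "u \<in> carrier (free_group X)" "v \<in> carrier (free_group X)" "w \<in> carrier (free_group X)"
  then show "u \<otimes>\<^bsub>free_group X\<^esub> v \<otimes>\<^bsub>free_group X\<^esub> w = u \<otimes>\<^bsub>free_group X\<^esub> (v \<otimes>\<^bsub>free_group X\<^esub> w)"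
    by (auto simp: free_group_def free_reduce_append reduced_foldr foldr_foldr)
next
  fix w assume "w \<in> carrier (free_group X)"
  then show "\<exists>v\<in>carrier (free_group X). v \<otimes>\<^bsub>free_group X\<^esub> w = \<one>\<^bsub>free_group X\<^esub>"
    using free_group_inverse by blast
next
  show "\<one>\<^bsub>free_group X\<^esub> \<in> carrier (free_group X)"
    by (simp add: free_group_def reduced_def)
next
  fix w assume "w \<in> carrier (free_group X)"
  then show "\<one>\<^bsub>free_group X\<^esub> \<otimes>\<^bsub>free_group X\<^esub> w = w"
    by (auto simp: free_group_def free_reduce_def foldr_reduced)
qed

lemma inv_free_group: "w \<in> carrier (free_group X) \<Longrightarrow> inv\<^bsub>free_group X\<^esub> w = word_inv w"
  by (rule group.inv_equality[OF group_free_group free_group_inverse(2) _ free_group_inverse(1)])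

record 'x presentation =
  gens :: "'x set"
  rels :: "'x word set"

definition normal_closure :: "('g, 'm) monoid_scheme \<Rightarrow> 'g set \<Rightarrow> 'g set" where
  "normal_closure G R = \<Inter>{N. N \<lhd> G \<and> R \<subseteq> N}"

definition presented_group :: "'x presentation \<Rightarrow> 'x word set monoid" where
  "presented_group P = free_group (gens P) Mod normal_closure (free_group (gens P)) (rels P)"

definition freely_conjugate :: "'x set \<Rightarrow> 'x word \<Rightarrow> 'x word \<Rightarrow> bool" where
  "freely_conjugate X r s \<longleftrightarrow>
     (let F = free_group X
      in \<exists>g\<in>carrier F. r = g \<otimes>\<^bsub>F\<^esub> s \<otimes>\<^bsub>F\<^esub> inv\<^bsub>F\<^esub> g)"

definition freely_redundant :: "'x presentation \<Rightarrow> 'x word \<Rightarrow> bool" where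
  "freely_redundant P r \<longleftrightarrow>
     (let F = free_group (gens P)
      in r = \<one>\<^bsub>F\<^esub> \<or>
         (\<exists>s\<in>rels P. r \<noteq> s \<and>
            (freely_conjugate (gens P) r s \<or> freely_conjugate (gens P) r (inv\<^bsub>F\<^esub> s))))"

definition non_redundant :: "'x presentation \<Rightarrow> bool" where
  "non_redundant P \<longleftrightarrow> (\<forall>r\<in>rels P. \<not> freely_redundant P r)"


section \<open>Cyclic presentations\<close>

text \<open>
  The generator \<open>x\<^sub>i\<close> is the number \<open>i < n\<close>. The map \<open>i \<mapsto> i + 1\<close> mod \<open>n\<close> is injective on
  these, so that applying it letterwise keeps words reduced and is the automorphism \<open>\<theta>\<close>
  of the free group.
\<close>

definition shift_word :: "nat \<Rightarrow> nat word \<Rightarrow> nat word" where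
  "shift_word n = map (map_letter (\<lambda>i. (i + 1) mod n))"

definition cyclic_presentation :: "nat \<Rightarrow> nat word \<Rightarrow> nat presentation" where
  "cyclic_presentation n w = \<lparr>gens = {..<n}, rels = {(shift_word n ^^ j) w | j. j < n}\<rparr>"

definition cyclic_group :: "nat \<Rightarrow> nat word \<Rightarrow> nat word set monoid" where
  "cyclic_group n w = presented_group (cyclic_presentation n w)"

definition irreducible_cyclic :: "nat \<Rightarrow> nat word \<Rightarrow> bool" where
  "irreducible_cyclic n w \<longleftrightarrow> Gcd (insert n (\<Union>a\<in>set w. set_letter a)) = 1"


section \<open>Undirected multigraphs\<close>

text \<open>
  The set \<open>ends G e\<close> consists of the one (for a loop) or two vertices joined by the edge \<open>e\<close>.
\<close>

record ('v, 'e) multigraph =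
  verts :: "'v set"
  edges :: "'e set"
  ends :: "'e \<Rightarrow> 'v set"

definition degree :: "('v, 'e) multigraph \<Rightarrow> 'v \<Rightarrow> nat" where
  "degree G v = card {e \<in> edges G. v \<in> ends G e} + card {e \<in> edges G. ends G e = {v}}"

fun walk :: "('v, 'e) multigraph \<Rightarrow> 'v \<Rightarrow> 'e list \<Rightarrow> 'v \<Rightarrow> bool" where
  "walk G u [] v \<longleftrightarrow> u \<in> verts G \<and> u = v"
| "walk G u (e # es) v \<longleftrightarrow>
     u \<in> verts G \<and> e \<in> edges G \<and> (\<exists>x. ends G e = {u, x} \<and> walk G x es v)"

definition connected_graph :: "('v, 'e) multigraph \<Rightarrow> bool" where
  "connected_graph G \<longleftrightarrow>
     verts G \<noteq> {} \<and> (\<forall>u\<in>verts G. \<forall>v\<in>verts G. \<exists>es. walk G u es v)"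

definition component :: "('v, 'e) multigraph \<Rightarrow> 'v \<Rightarrow> ('v, 'e) multigraph" where
  "component G u =
     \<lparr>verts = {v. \<exists>es. walk G u es v},
      edges = {e \<in> edges G. ends G e \<subseteq> {v. \<exists>es. walk G u es v}},
      ends = ends G\<rparr>"

definition components :: "('v, 'e) multigraph \<Rightarrow> ('v, 'e) multigraph set" where
  "components G = component G ` verts G"

definition graph_isomorphic :: "('v, 'e) multigraph \<Rightarrow> ('w, 'f) multigraph \<Rightarrow> bool" where
  "graph_isomorphic G H \<longleftrightarrow>
     (\<exists>f g. bij_betw f (verts G) (verts H) \<and> bij_betw g (edges G) (edges H) \<and>
            (\<forall>e\<in>edges G. ends H (g e) = f ` ends G e))"

definition bipartite :: "('v, 'e) multigraph \<Rightarrow> bool" where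
  "bipartite G \<longleftrightarrow>
     (\<exists>A B. A \<union> B = verts G \<and> A \<inter> B = {} \<and>
            (\<forall>e\<in>edges G. \<exists>a\<in>A. \<exists>b\<in>B. ends G e = {a, b}))"

definition graph_dist :: "('v, 'e) multigraph \<Rightarrow> 'v \<Rightarrow> 'v \<Rightarrow> enat" where
  "graph_dist G u v = (INF es\<in>{es. walk G u es v}. enat (length es))"

definition diameter :: "('v, 'e) multigraph \<Rightarrow> enat" where
  "diameter G = (SUP (u, v)\<in>verts G \<times> verts G. graph_dist G u v)"

text \<open>
  The last and the first edge of a closed path are not compared: deleting them if they are
  equal gives a shorter closed path, so this does not affect the minimum, and a loop counts
  as a closed path of length 1.
\<close>

definition girth :: "('v, 'e) multigraph \<Rightarrow> enat" where
  "girth G =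
     (INF es\<in>{es. es \<noteq> [] \<and> successively (\<noteq>) es \<and> (\<exists>v. walk G v es v)}. enat (length es))"


section \<open>Star graphs and special presentations\<close>

definition symmetrized_rels :: "'x presentation \<Rightarrow> 'x word set" where
  "symmetrized_rels P = {rotate i r | i r. r \<in> rels P \<union> word_inv ` rels P}"

text \<open>
  An edge is the unordered pair of the words \<open>x y\<^sup>-\<^sup>1 u\<close> and \<open>y x\<^sup>-\<^sup>1 u\<^sup>-\<^sup>1\<close>; the vertices
  \<open>x\<close> and \<open>y\<close> that it joins are the first letters of these two words.
\<close>

definition star_graph :: "'x presentation \<Rightarrow> ('x letter, 'x word set) multigraph" where
  "star_graph P =
     \<lparr>verts = letters (gens P),
      edges = {{x # letter_inv y # u, y # letter_inv x # word_inv u} | x y u.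
                 x # letter_inv y # u \<in> symmetrized_rels P},
      ends = (\<lambda>e. hd ` e)\<rparr>"

definition special :: "nat \<Rightarrow> nat \<Rightarrow> nat \<Rightarrow> 'x presentation \<Rightarrow> bool" where
  "special m k \<nu> P \<longleftrightarrow>
     m \<ge> 2 \<and> k \<ge> 3 \<and> \<nu> \<ge> 1 \<and>
     finite (gens P) \<and> finite (rels P) \<and> rels P \<subseteq> carrier (free_group (gens P)) \<and>
     (\<forall>r\<in>rels P. cyclically_reduced r) \<and>
     card (components (star_graph P)) = \<nu> \<and>
     (\<forall>C\<in>components (star_graph P). \<forall>D\<in>components (star_graph P). graph_isomorphic C D) \<and>
     (\<forall>C\<in>components (star_graph P).
        connected_graph C \<and> bipartite C \<and> diameter C = enat m \<and> girth C = enat (2 * m) \<and>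
        (\<forall>v\<in>verts C. degree C v \<ge> 3)) \<and>
     (\<forall>r\<in>rels P. length r = k) \<and>
     (m = 2 \<longrightarrow> k \<ge> 4)"

end

(*
  The relator alternates in sign, so the star graph splits into a positive and a negative part: two
  circulant graphs on Z/n, with steps {a1, a2, -a1, -a2} and {b1, b2, -b1, -b2}, where
  b2 = -(a1 + b1 + a2). A bipartite graph of diameter 2 contains an edge between the ends of every
  walk of length 3, so both step sets are closed under triple sums; girth 4 and degree at least 3
  make the four steps distinct. This forces 8 a1 = 0, 4 a1 <> 0 and a2 = 3 a1 or a2 = -3 a1 mod n,
  likewise for b1 and b2, and then n = 8 by irreducibility. Conversely, for n = 8 these conditions
  say that the steps are all the odd residues, so each part of the star graph is K_{4,4}.

  For the isomorphisms, a1 is odd, so the relators alternate between even and odd subscripts.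
  Inverting the generators with odd subscript, combined with an affine relabelling of the subscripts
  on each parity class, makes them positive up to rotation and inversion.
*)

theory Submission
  imports Defs
begin

section \<open>Isomorphisms of presented groups\<close>

text \<open>The splitting by sign comes from how the star graph reads a word: a subword of the form
  x_i x_j^-1 gives an edge between x_i and x_j, so both ends carry the sign of the first letter. If
  a relator is stored by the differences of successive subscripts, rotation and inversion become
  operations on tuples of differences, and an edge becomes a step by the first difference. The
  obstacle is that the star graph is a multigraph whose edges are pairs of words. Different edges
  may have the same ends, and two words name the same edge. When \<open>2 * a = 0\<close>, the edges
  leaving 0 and \<open>a\<close> by the step \<open>a\<close> have the same ends, and only a
  comparison of their words shows whether they are one edge or two. The number 8 comes from the fact
  that Z/n has at most one element of order 2, so that a + c and a - c cannot both be of order 2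
  unless 2a = 0.\<close>

lemma (in group) carrier_normal: "carrier G \<lhd> G"
  by (auto simp: normal_inv_iff subgroup_self)

lemma (in group_hom) normal_preimage:
  assumes "K \<lhd> H"
  shows "{x \<in> carrier G. h x \<in> K} \<lhd> G"
proof -
  interpret K: normal K H by fact
  have "subgroup {x \<in> carrier G. h x \<in> K} G"
    by (rule G.subgroupI) auto
  then show ?thesis
    using K.inv_op_closed2 by (auto simp: G.normal_inv_iff)
qed

lemma normal_closure_subset: "R \<subseteq> normal_closure G R"
  by (auto simp: normal_closure_def)

lemma normal_closure_least: "N \<lhd> G \<Longrightarrow> R \<subseteq> N \<Longrightarrow> normal_closure G R \<subseteq> N"
  by (auto simp: normal_closure_def)

text \<open>\<open>normal_closure\<close> is a bare intersection, which for an empty family would be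
  the whole type. The carrier, a normal subgroup that contains \<open>R\<close>, keeps the family
  nonempty.\<close>

lemma normal_closure_normal:
  assumes "group G" "R \<subseteq> carrier G"
  shows "normal_closure G R \<lhd> G"
proof -
  interpret group G by fact
  have "carrier G \<in> {N. N \<lhd> G \<and> R \<subseteq> N}"
    using carrier_normal assms by auto
  moreover have "subgroup (normal_closure G R) G"
    unfolding normal_closure_def
    by (rule subgroups_Inter) (use calculation in \<open>auto simp: normal_inv_iff\<close>)
  ultimately show ?thesis
    by (auto simp: normal_inv_iff normal_closure_def)
qed

text \<open>First isomorphism theorem for \<open>f\<close> followed by the projection modulo the
  image of \<open>N\<close>; injectivity of \<open>f\<close> makes the kernel exactly
  \<open>N\<close>.\<close>

lemma iso_Mod:
  assumes "group G" "group H" and f: "f \<in> iso G H" and N: "N \<lhd> G"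
  shows "G Mod N \<cong> H Mod f ` N"
proof -
  interpret G: group G by fact
  interpret N: normal N G by fact
  interpret M: normal "f ` N" H
    using iso_normal_subgroup[OF f] assms by blast
  have hom: "f \<in> hom G H" and inj: "inj_on f (carrier G)" and surj: "f ` carrier G = carrier H"
    using f by (auto simp: iso_iff)
  define g where "g = (\<lambda>x. f ` N #>\<^bsub>H\<^esub> f x)"
  have "(\<lambda>y. f ` N #>\<^bsub>H\<^esub> y) \<circ> f \<in> hom G (H Mod f ` N)"
    by (rule hom_compose[OF hom M.r_coset_hom_Mod])
  then have "group_hom G (H Mod f ` N) g"
    by (simp add: group_hom_def group_hom_axioms_def g_def comp_def M.factorgroup_is_group \<open>group G\<close>)
  then interpret g: group_hom G "H Mod f ` N" g .
  have "g ` carrier G = carrier (H Mod f ` N)"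
    unfolding g_def FactGroup_def RCOSETS_def by (auto simp flip: surj)
  moreover have "Coset.kernel G (H Mod f ` N) g = N"
  proof (intro equalityI subsetI)
    fix x assume "x \<in> Coset.kernel G (H Mod f ` N) g"
    then have x: "x \<in> carrier G" and "f ` N #>\<^bsub>H\<^esub> f x = f ` N"
      by (auto simp: kernel_def g_def FactGroup_def)
    then have "f x \<in> f ` N"
      using M.coset_join1[of "f ` N" "f x"] imageI[OF x, of f] surj M.subgroup_axioms by simp
    then show "x \<in> N"
      using x inj N.subset by (auto simp: inj_on_def)
  next
    fix x assume "x \<in> N"
    then show "x \<in> Coset.kernel G (H Mod f ` N) g"
      using M.rcos_const[of "f x"] N.subset \<open>group H\<close>
      by (auto simp: kernel_def g_def FactGroup_def)
  qed
  ultimately show ?thesis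
    using g.FactGroup_iso by metis
qed

section \<open>Letter bijections as isomorphisms of free groups\<close>

lemma cancel_cons_map:
  assumes "inj_on h (letters X)" and "\<And>a. a \<in> letters X \<Longrightarrow> h (letter_inv a) = letter_inv (h a)"
    and "a \<in> letters X" "set w \<subseteq> letters X"
  shows "cancel_cons (h a) (map h w) = map h (cancel_cons a w)"
proof (cases w)
  case (Cons b v)
  have "letter_inv a \<in> letters X"
    using \<open>a \<in> letters X\<close> by (auto simp: letters_def)
  then have "h b = letter_inv (h a) \<longleftrightarrow> b = letter_inv a"
    using assms Cons by (metis inj_onD list.set_intros(1) subset_iff)
  then show ?thesis
    using Cons by simp
qed simp

lemma free_reduce_map:
  assumes "inj_on h (letters X)" and "\<And>a. a \<in> letters X \<Longrightarrow> h (letter_inv a) = letter_inv (h a)"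
    and "set w \<subseteq> letters X"
  shows "free_reduce (map h w) = map h (free_reduce w)"
  using assms(3) unfolding free_reduce_def
proof (induction w)
  case (Cons a w)
  then show ?case
    using cancel_cons_map[OF assms(1,2), of a "foldr cancel_cons w []"] set_foldr[of w "[]"] by auto
qed simp

lemma reduced_iff_free_reduce: "reduced w \<longleftrightarrow> free_reduce w = w"
  by (metis foldr_reduced free_reduce_def reduced_def reduced_foldr successively.simps(1))

text \<open>An injective letter map that commutes with inversion neither creates nor destroys
  cancellations, so it commutes with free reduction. It acts on letters rather than generators so
  that a generator may be sent to an inverse.\<close>

lemma map_iso_free_group:
  assumes bij: "bij_betw h (letters X) (letters Y)"
    and inv: "\<And>a. a \<in> letters X \<Longrightarrow> h (letter_inv a) = letter_inv (h a)"
  shows "map h \<in> iso (free_group X) (free_group Y)"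
proof -
  have inj: "inj_on h (letters X)" and surj: "h ` letters X = letters Y"
    using bij by (auto simp: bij_betw_def)
  have map_inj: "map h u = map h v \<longleftrightarrow> u = v" if "set u \<subseteq> letters X" "set v \<subseteq> letters X" for u v
    using map_inj_on[of h u v] inj_on_subset[OF inj, of "set u \<union> set v"] that by auto
  have reduced_map: "reduced (map h w) \<longleftrightarrow> reduced w" if "set w \<subseteq> letters X" for w
  proof -
    have "set (free_reduce w) \<subseteq> letters X"
      using that set_foldr[of w "[]"] by (auto simp: free_reduce_def)
    then show ?thesis
      using that by (simp add: reduced_iff_free_reduce free_reduce_map[where h = h, OF inj inv] map_inj)
  qed
  have "map h ` carrier (free_group X) = carrier (free_group Y)"
  proof (intro equalityI subsetI)
    fix v assume v: "v \<in> carrier (free_group Y)"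
    then have "v \<in> lists (h ` letters X)"
      by (auto simp: free_group_def surj)
    then obtain u where "v = map h u" "set u \<subseteq> letters X"
      unfolding lists_image by auto
    then show "v \<in> map h ` carrier (free_group X)"
      using v by (auto simp: free_group_def reduced_map)
  next
    fix v assume "v \<in> map h ` carrier (free_group X)"
    then show "v \<in> carrier (free_group Y)"
      using surj by (fastforce simp: free_group_def reduced_map)
  qed
  moreover have "inj_on (map h) (carrier (free_group X))"
    using map_inj by (auto simp: inj_on_def free_group_def)
  moreover have "map h \<in> hom (free_group X) (free_group Y)"
  proof (rule homI)
    fix u v assume "u \<in> carrier (free_group X)" "v \<in> carrier (free_group X)"
    then show "map h (u \<otimes>\<^bsub>free_group X\<^esub> v) = map h u \<otimes>\<^bsub>free_group Y\<^esub> map h v"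
      using free_reduce_map[where h = h, OF inj inv, of "u @ v"] by (simp add: free_group_def)
  qed (use calculation in blast)
  ultimately show ?thesis
    by (simp add: iso_iff)
qed

text \<open>Rotating a word conjugates the element it represents, so related words have the same
  normal closure.\<close>

definition cyclically_equivalent :: "'x word \<Rightarrow> 'x word \<Rightarrow> bool" where
  "cyclically_equivalent u v \<longleftrightarrow> (\<exists>i. v = rotate i u \<or> v = rotate i (word_inv u))"

text \<open>For \<open>u = a @ b\<close> the rotation \<open>b @ a\<close> is the conjugate of
  \<open>u\<close> by \<open>a\<close>. Rotating a reduced word may bring cancelling letters
  together, so the carrier condition on the rotation has to be imposed.\<close>

lemma normal_rotate:
  assumes N: "N \<lhd> free_group X" and u: "u \<in> N" and v: "rotate i u \<in> carrier (free_group X)"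
  shows "rotate i u \<in> N"
proof -
  interpret normal N "free_group X" by fact
  define a where "a = take (i mod length u) u"
  define b where "b = drop (i mod length u) u"
  have ab: "u = a @ b" "rotate i u = b @ a"
    by (simp_all add: a_def b_def rotate_drop_take)
  have "set (a @ b) \<subseteq> letters X" "reduced (a @ b)" "reduced (b @ a)"
    using mem_carrier[OF u] v ab by (simp_all add: free_group_def)
  moreover from this have "reduced a" "reduced b"
    by (auto simp: reduced_def successively_append_iff)
  ultimately have a: "a \<in> carrier (free_group X)" and b: "b \<in> carrier (free_group X)"
    and "a \<otimes>\<^bsub>free_group X\<^esub> b = u" "b \<otimes>\<^bsub>free_group X\<^esub> a = rotate i u"
    using ab by (auto simp: free_group_def reduced_iff_free_reduce)
  then have "rotate i u = inv\<^bsub>free_group X\<^esub> a \<otimes>\<^bsub>free_group X\<^esub> u \<otimes>\<^bsub>free_group X\<^esub> a"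
    by (metis m_assoc inv_closed m_closed l_inv l_one)
  then show ?thesis
    using inv_op_closed1[OF a u] by simp
qed

lemma normal_cyclically_equivalent:
  assumes N: "N \<lhd> free_group X" and u: "u \<in> N" and "v \<in> carrier (free_group X)"
    and "cyclically_equivalent u v"
  shows "v \<in> N"
proof -
  interpret normal N "free_group X" by fact
  have "word_inv u \<in> N"
    using m_inv_closed[OF u] inv_free_group[OF mem_carrier[OF u]] by simp
  then show ?thesis
    using assms normal_rotate[OF N] by (auto simp: cyclically_equivalent_def)
qed

text \<open>No map between the quotients is built by hand: the image of \<open>?N\<close> is shown
  to equal \<open>?M\<close>. The image is normal and contains \<open>rels Q\<close>, the preimage
  of \<open>?M\<close> is normal and contains \<open>rels P\<close>, and minimality of normal
  closures gives the two inclusions.\<close>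

lemma presented_group_iso:
  assumes bij: "bij_betw h (letters (gens P)) (letters (gens Q))"
    and inv: "\<And>a. a \<in> letters (gens P) \<Longrightarrow> h (letter_inv a) = letter_inv (h a)"
    and P: "rels P \<subseteq> carrier (free_group (gens P))"
    and Q: "rels Q \<subseteq> carrier (free_group (gens Q))"
    and PQ: "\<And>r. r \<in> rels P \<Longrightarrow> \<exists>q\<in>rels Q. cyclically_equivalent q (map h r)"
    and QP: "\<And>q. q \<in> rels Q \<Longrightarrow> \<exists>r\<in>rels P. cyclically_equivalent (map h r) q"
  shows "presented_group P \<cong> presented_group Q"
proof -
  let ?F = "free_group (gens P)" and ?E = "free_group (gens Q)"
  let ?N = "normal_closure ?F (rels P)" and ?M = "normal_closure ?E (rels Q)"
  have F: "group ?F" and E: "group ?E"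
    by (rule group_free_group)+
  have iso: "map h \<in> iso ?F ?E"
    by (rule map_iso_free_group[where h = h, OF bij inv])
  then have hom: "group_hom ?F ?E (map h)"
    by (intro group_hom.intro group_hom_axioms.intro F E iso_imp_homomorphism)
  have N: "?N \<lhd> ?F"
    by (rule normal_closure_normal[OF F P])
  have M: "?M \<lhd> ?E"
    by (rule normal_closure_normal[OF E Q])
  have hN: "map h ` ?N \<lhd> ?E"
    by (rule iso_normal_subgroup[OF iso F E N])
  have "?M \<subseteq> map h ` ?N"
  proof (rule normal_closure_least[OF hN], rule subsetI)
    fix q assume q: "q \<in> rels Q"
    then obtain r where "r \<in> rels P" "cyclically_equivalent (map h r) q"
      using QP by blast
    moreover from this have "map h r \<in> map h ` ?N"
      using normal_closure_subset[of "rels P" ?F] by auto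
    ultimately show "q \<in> map h ` ?N"
      using normal_cyclically_equivalent[OF hN] q Q by auto
  qed
  moreover have "map h ` ?N \<subseteq> ?M"
  proof -
    let ?K = "{x \<in> carrier ?F. map h x \<in> ?M}"
    have "?K \<lhd> ?F"
      by (rule group_hom.normal_preimage[OF hom M])
    moreover have "rels P \<subseteq> ?K"
    proof
      fix r assume r: "r \<in> rels P"
      then obtain q where "q \<in> rels Q" "cyclically_equivalent q (map h r)"
        using PQ by blast
      moreover from this have "q \<in> ?M"
        using normal_closure_subset[of "rels Q" ?E] by auto
      moreover have "map h r \<in> carrier ?E"
        using group_hom.hom_closed[OF hom] P r by auto
      ultimately have "map h r \<in> ?M"
        using normal_cyclically_equivalent[OF M] by simp
      then show "r \<in> ?K"
        using P r by auto
    qed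
    ultimately show ?thesis
      using normal_closure_least by blast
  qed
  ultimately show ?thesis
    using iso_Mod[OF F E iso N] by (auto simp: presented_group_def)
qed

section \<open>Multigraphs\<close>

lemma walk_ends: "walk G u es v \<Longrightarrow> u \<in> verts G \<and> v \<in> verts G"
  by (induction es arbitrary: u) auto

lemma walk_append: "walk G u es v \<Longrightarrow> walk G v fs x \<Longrightarrow> walk G u (es @ fs) x"
  by (induction es arbitrary: u) auto

lemma walk_bipartite:
  assumes "\<And>e. e \<in> edges G \<Longrightarrow> \<exists>a\<in>A. \<exists>b\<in>B. ends G e = {a, b}" and "A \<inter> B = {}"
    and "walk G u es v" and "u \<in> A \<union> B"
  shows "u \<in> A \<longleftrightarrow> (v \<in> A \<longleftrightarrow> even (length es))"
  using assms(3,4)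
proof (induction es arbitrary: u)
  case (Cons e es)
  then obtain x a b where "ends G e = {u, x}" "walk G x es v" "a \<in> A" "b \<in> B" "ends G e = {a, b}"
    using assms(1) by (metis walk.simps(2))
  then have "walk G x es v" "u \<in> A \<and> x \<in> B \<or> u \<in> B \<and> x \<in> A"
    by (auto simp: doubleton_eq_iff)
  then show ?case
    using Cons.IH[of x] \<open>A \<inter> B = {}\<close> by auto
qed auto

lemma graph_dist_le: "walk G u es v \<Longrightarrow> graph_dist G u v \<le> enat (length es)"
  unfolding graph_dist_def by (rule INF_lower) simp

lemma graph_dist_ge: "(\<And>es. walk G u es v \<Longrightarrow> m \<le> length es) \<Longrightarrow> enat m \<le> graph_dist G u v"
  unfolding graph_dist_def by (rule INF_greatest) simp

lemma girth_le: "walk G v es v \<Longrightarrow> es \<noteq> [] \<Longrightarrow> successively (\<noteq>) es \<Longrightarrow> girth G \<le> enat (length es)"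
  unfolding girth_def by (rule INF_lower) auto

text \<open>All walks from \<open>u\<close> to \<open>v\<close> have the same parity, here odd, and
  some walk has length at most 2; that walk is a single edge.\<close>

lemma bipartite_diameter_2_edge:
  assumes "bipartite G" and diam: "diameter G \<le> enat 2" and w: "walk G u es v" "odd (length es)"
  shows "\<exists>e\<in>edges G. ends G e = {u, v}"
proof -
  obtain A B where AB: "A \<union> B = verts G" "A \<inter> B = {}"
    and e: "\<And>e. e \<in> edges G \<Longrightarrow> \<exists>a\<in>A. \<exists>b\<in>B. ends G e = {a, b}"
    using \<open>bipartite G\<close> unfolding bipartite_def by metis
  have uv: "u \<in> verts G" "v \<in> verts G"
    using w walk_ends by metis+
  have "graph_dist G u v \<le> diameter G"
    unfolding diameter_def by (rule SUP_upper2[of "(u, v)"]) (use uv in auto)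
  with diam have "graph_dist G u v \<le> enat 2"
    by (rule order_trans[rotated])
  \<comment> \<open>The distance is an infimum, so a short walk is obtained by contraposition: if
    every walk had length at least 3, so would the distance.\<close>
  then have "\<not> enat 3 \<le> graph_dist G u v"
    using order_trans[of "enat 3" _ "enat 2"] by auto
  then obtain fs where fs: "walk G u fs v" "length fs < 3"
    using graph_dist_ge[of G u v 3] by (meson not_less)
  moreover have "odd (length fs)"
    using walk_bipartite[OF e AB(2) fs(1)] walk_bipartite[OF e AB(2) w(1)] uv w(2) AB(1) by auto
  ultimately have "length fs = 1"
    by presburger
  then obtain f where "fs = [f]"
    by (auto simp: length_Suc_conv)
  then show ?thesis
    using fs by auto
qed

lemma parallel_edges_girth:
  assumes "e \<in> edges G" "e' \<in> edges G" "ends G e = {u, v}" "ends G e' = {u, v}"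
    and "u \<in> verts G" "v \<in> verts G" "enat 2 < girth G"
  shows "e = e'"
proof (rule ccontr)
  assume "e \<noteq> e'"
  moreover have "walk G u [e, e'] u"
    using assms by auto
  ultimately have "girth G \<le> enat 2"
    using girth_le[of G u "[e, e']"] by (simp add: numeral_2_eq_2 del: walk.simps)
  then show False
    using assms(7) by simp
qed

section \<open>Complete bipartite graphs\<close>

lemma two_elements: "3 \<le> card A \<Longrightarrow> \<exists>a b. a \<in> A \<and> b \<in> A \<and> a \<noteq> b"
  by (metis card_le_Suc0_iff_eq card.infinite not_less_eq_eq not_numeral_le_zero numeral_3_eq_3 le_SucI)

text \<open>Requiring a bijection, and not only the right set of values of \<open>ends\<close>,
  excludes parallel edges.\<close>

definition complete_bipartite :: "('v, 'e) multigraph \<Rightarrow> 'v set \<Rightarrow> 'v set \<Rightarrow> bool" where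
  "complete_bipartite G A B \<longleftrightarrow> verts G = A \<union> B \<and> A \<inter> B = {} \<and>
     bij_betw (ends G) (edges G) {{a, b} | a b. a \<in> A \<and> b \<in> B}"

lemma complete_bipartite_commute: "complete_bipartite G A B \<Longrightarrow> complete_bipartite G B A"
proof -
  have "{{a, b} | a b. a \<in> A \<and> b \<in> B} = {{a, b} | a b. a \<in> B \<and> b \<in> A}"
    by (auto intro: insert_commute)
  then show "complete_bipartite G A B \<Longrightarrow> complete_bipartite G B A"
    by (auto simp: complete_bipartite_def)
qed

lemma complete_bipartite_edge:
  assumes "complete_bipartite G A B" "a \<in> A" "b \<in> B"
  shows "\<exists>e\<in>edges G. ends G e = {a, b}"
proof -
  have "{a, b} \<in> ends G ` edges G"
    using assms unfolding complete_bipartite_def bij_betw_def by auto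
  then show ?thesis
    by auto
qed

lemma complete_bipartite_ends:
  assumes "complete_bipartite G A B" "e \<in> edges G"
  shows "\<exists>a\<in>A. \<exists>b\<in>B. ends G e = {a, b}"
proof -
  have "ends G e \<in> {{a, b} | a b. a \<in> A \<and> b \<in> B}"
    using assms imageI[of e "edges G" "ends G"] by (simp add: complete_bipartite_def bij_betw_def)
  then show ?thesis
    by auto
qed

lemma complete_bipartite_bipartite: "complete_bipartite G A B \<Longrightarrow> bipartite G"
  unfolding bipartite_def using complete_bipartite_ends[of G A B]
  by (intro exI[of _ A] exI[of _ B]) (simp add: complete_bipartite_def)

lemma complete_bipartite_isomorphic:
  assumes G: "complete_bipartite G A B" and H: "complete_bipartite H A' B'"
    and f: "bij_betw f A A'" "bij_betw f B B'"
  shows "graph_isomorphic G H"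
proof -
  let ?E = "{{a, b} | a b. a \<in> A \<and> b \<in> B}" and ?E' = "{{a, b} | a b. a \<in> A' \<and> b \<in> B'}"
  have V: "bij_betw f (verts G) (verts H)"
    using bij_betw_combine[OF f] G H by (auto simp: complete_bipartite_def)
  have "(`) f ` ?E = ?E'"
  proof (intro equalityI subsetI)
    fix X assume "X \<in> ?E'"
    then obtain a b where "a \<in> A" "b \<in> B" "X = {f a, f b}"
      using f by (auto simp: bij_betw_def)
    then show "X \<in> (`) f ` ?E"
      by (intro image_eqI[of _ _ "{a, b}"]) auto
  qed (use f in \<open>auto simp: bij_betw_def\<close>)
  moreover have "inj_on ((`) f) ?E"
    using G V by (intro inj_on_subset[OF inj_on_image_Pow[of f "verts G"]])
      (auto simp: complete_bipartite_def bij_betw_def)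
  ultimately have "bij_betw ((`) f) ?E ?E'"
    by (simp add: bij_betw_def)
  moreover have e: "bij_betw (ends G) (edges G) ?E" and e': "bij_betw (ends H) (edges H) ?E'"
    using G H by (auto simp: complete_bipartite_def)
  \<comment> \<open>An edge of \<open>H\<close> is determined by its ends, so the edge map takes
    ends, applies \<open>f\<close> and inverts \<open>ends H\<close>.\<close>
  ultimately have g: "bij_betw (inv_into (edges H) (ends H) \<circ> ((`) f \<circ> ends G)) (edges G) (edges H)"
    (is "bij_betw ?g _ _") by (meson bij_betw_inv_into bij_betw_trans)
  moreover have "ends H (?g e) = f ` ends G e" if "e \<in> edges G" for e
  proof -
    have "f ` ends G e \<in> ?E'"
      using that e \<open>(`) f ` ?E = ?E'\<close> by (metis (no_types, lifting) bij_betwE image_eqI)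
    then show ?thesis
      using bij_betw_inv_into_right[OF e'] by simp
  qed
  ultimately show ?thesis
    using V unfolding graph_isomorphic_def by blast
qed

text \<open>Three vertices on each side give every condition on a component. The bounds also make
  both sides finite, which matters for \<open>degree\<close> since \<open>card\<close> of an
  infinite set is 0.\<close>

context
  fixes G :: "('v, 'e) multigraph" and A B :: "'v set"
  assumes G: "complete_bipartite G A B" and A: "card A \<ge> 3" and B: "card B \<ge> 3"
begin

lemma complete_bipartite_walk:
  assumes "u \<in> verts G" "v \<in> verts G"
  shows "\<exists>es. walk G u es v \<and> length es \<le> 2"
proof -
  have *: "\<exists>es. walk G u es v \<and> length es \<le> 2"
    if G: "complete_bipartite G A B" and b: "b \<in> B" and u: "u \<in> A" and v: "v \<in> A \<union> B" for A B b u v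
  proof (cases "v \<in> A")
    case True
    obtain e e' where "e \<in> edges G" "ends G e = {u, b}" "e' \<in> edges G" "ends G e' = {v, b}"
      using complete_bipartite_edge[OF G u b] complete_bipartite_edge[OF G True b] by blast
    then have "walk G u [e, e'] v"
      using G u b True by (auto simp: complete_bipartite_def insert_commute)
    then show ?thesis
      by (intro exI[of _ "[e, e']"]) simp
  next
    case False
    then obtain e where "e \<in> edges G" "ends G e = {u, v}"
      using complete_bipartite_edge[OF G u, of v] v by blast
    then have "walk G u [e] v"
      using G u v by (auto simp: complete_bipartite_def)
    then show ?thesis
      by (intro exI[of _ "[e]"]) simp
  qed
  obtain a b where "a \<in> A" "b \<in> B"
    using A B by (metis all_not_in_conv card.empty not_numeral_le_zero)
  then show ?thesis
    using *[OF G, of b u v] *[OF complete_bipartite_commute[OF G], of a u v] assms G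
    by (auto simp: complete_bipartite_def)
qed

lemma complete_bipartite_connected: "connected_graph G"
proof -
  have "verts G \<noteq> {}"
    using G A by (auto simp: complete_bipartite_def)
  then show ?thesis
    using complete_bipartite_walk unfolding connected_graph_def by blast
qed

lemma complete_bipartite_diameter: "diameter G = enat 2"
proof (rule antisym)
  show "diameter G \<le> enat 2"
    unfolding diameter_def
  proof (rule SUP_least, clarify)
    fix u v assume "u \<in> verts G" "v \<in> verts G"
    then obtain es where "walk G u es v" "length es \<le> 2"
      using complete_bipartite_walk by blast
    then show "graph_dist G u v \<le> enat 2"
      using graph_dist_le[of G u es v] by (meson enat_ord_simps(1) order_trans)
  qed
  obtain a b where ab: "a \<in> A" "b \<in> A" "a \<noteq> b"
    using two_elements[OF A] by blast
  then have V: "a \<in> verts G" "b \<in> verts G"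
    using G by (auto simp: complete_bipartite_def)
  have "enat 2 \<le> graph_dist G a b"
  proof (rule graph_dist_ge)
    fix es assume w: "walk G a es b"
    have "A \<inter> B = {}"
      using G by (simp add: complete_bipartite_def)
    then have "even (length es)"
      using walk_bipartite[OF complete_bipartite_ends[OF G] _ w] ab by simp
    moreover have "es \<noteq> []"
      using w ab by auto
    ultimately show "2 \<le> length es"
      by (cases es) (auto simp: Suc_le_eq)
  qed
  then show "enat 2 \<le> diameter G"
    unfolding diameter_def by (intro SUP_upper2[of "(a, b)"]) (use V in auto)
qed

lemma complete_bipartite_girth: "girth G = enat 4"
proof (rule antisym)
  have AB: "A \<inter> B = {}"
    using G by (simp add: complete_bipartite_def)
  obtain a b where ab: "a \<in> A" "b \<in> A" "a \<noteq> b"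
    using two_elements[OF A] by blast
  obtain c d where cd: "c \<in> B" "d \<in> B" "c \<noteq> d"
    using two_elements[OF B] by blast
  obtain e1 e2 e3 e4 where e: "e1 \<in> edges G" "ends G e1 = {a, c}" "e2 \<in> edges G" "ends G e2 = {b, c}"
    "e3 \<in> edges G" "ends G e3 = {b, d}" "e4 \<in> edges G" "ends G e4 = {a, d}"
    using complete_bipartite_edge[OF G] ab cd by metis
  then have "walk G a [e1, e2, e3, e4] a"
    using G ab cd by (auto simp: complete_bipartite_def insert_commute)
  moreover have "successively (\<noteq>) [e1, e2, e3, e4]"
    using e ab cd by (auto simp: doubleton_eq_iff)
  ultimately show "girth G \<le> enat 4"
    using girth_le[of G a "[e1, e2, e3, e4]"] by (simp add: eval_nat_numeral del: walk.simps)
  show "enat 4 \<le> girth G"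
    unfolding girth_def
  proof (rule INF_greatest, clarify)
    fix es v assume es: "es \<noteq> []" "successively (\<noteq>) es" and w: "walk G v es v"
    have "v \<in> A \<union> B"
      using walk_ends[OF w] G by (simp add: complete_bipartite_def)
    then have "even (length es)"
      using walk_bipartite[OF complete_bipartite_ends[OF G] AB w] by auto
    \<comment> \<open>A closed walk of two edges uses the same ends twice, hence the same edge
      twice. By parity the next possible length is 4.\<close>
    moreover have "length es \<noteq> 2"
    proof
      assume "length es = 2"
      then obtain e e' where "es = [e, e']"
        by (auto simp: numeral_2_eq_2 length_Suc_conv)
      then have "e \<in> edges G" "e' \<in> edges G" "e \<noteq> e'" "ends G e = ends G e'"
        using w es by (auto simp: insert_commute)
      then show False
        using G unfolding complete_bipartite_def bij_betw_def inj_on_def by blast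
    qed
    moreover have "length es \<noteq> 0"
      using es by simp
    ultimately have "4 \<le> length es"
      by presburger
    then show "enat 4 \<le> enat (length es)"
      by simp
  qed
qed

lemma complete_bipartite_degree:
  assumes "v \<in> verts G"
  shows "degree G v \<ge> 3"
proof -
  have *: "3 \<le> card {e \<in> edges G. v \<in> ends G e}"
    if G: "complete_bipartite G A B" and B: "card B \<ge> 3" and v: "v \<in> A" for A B
  proof -
    have inj: "inj_on (ends G) (edges G)" and AB: "A \<inter> B = {}"
      using G by (auto simp: complete_bipartite_def bij_betw_def)
    have "(\<lambda>b. {v, b}) ` B \<subseteq> ends G ` {e \<in> edges G. v \<in> ends G e}"
      using complete_bipartite_edge[OF G v] by fastforce
    moreover have "ends G ` {e \<in> edges G. v \<in> ends G e} \<subseteq> (\<lambda>b. {v, b}) ` B"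
      using complete_bipartite_ends[OF G] AB v by fastforce
    ultimately have "ends G ` {e \<in> edges G. v \<in> ends G e} = (\<lambda>b. {v, b}) ` B"
      by simp
    moreover have "inj_on (\<lambda>b. {v, b}) B"
      by (auto simp: inj_on_def doubleton_eq_iff)
    moreover have "inj_on (ends G) {e \<in> edges G. v \<in> ends G e}"
      using inj by (rule inj_on_subset) auto
    ultimately have "card {e \<in> edges G. v \<in> ends G e} = card B"
      by (simp flip: card_image)
    then show ?thesis
      using B by simp
  qed
  have "v \<in> A \<or> v \<in> B"
    using assms G by (auto simp: complete_bipartite_def)
  then show ?thesis
    using *[OF G B] *[OF complete_bipartite_commute[OF G] A] by (auto simp: degree_def)
qed

end

text \<open>This carries walks found in the whole graph into a component, the graph whose diameter
  and girth are known.\<close>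

lemma component_walk:
  assumes "walk G u es v" "u \<in> verts (component G c)"
  shows "walk (component G c) u es v"
  using assms
proof (induction es arbitrary: u)
  case (Cons e es)
  then obtain x where x: "e \<in> edges G" "ends G e = {u, x}" "walk G x es v"
    by auto
  obtain fs where "walk G c fs u"
    using Cons.prems(2) by (auto simp: component_def)
  moreover have "walk G u [e] x"
    using x walk_ends[OF x(3)] walk_ends[OF Cons.prems(1)] by auto
  ultimately have "walk G c (fs @ [e]) x"
    by (rule walk_append)
  then have "x \<in> verts (component G c)"
    by (auto simp: component_def)
  then show ?case
    using Cons.IH[of x] Cons.prems(2) x by (auto simp: component_def)
qed (auto simp: component_def)

section \<open>Arithmetic\<close>

lemma dvd_linear_combination:
  fixes x y z N :: int
  assumes "N dvd x" "N dvd y" "z = i * x + j * y"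
  shows "N dvd z"
  using assms by simp

text \<open>Discarding the excluded values of a + a + c and a + a - c leaves, mod \<open>N\<close>:
  \<open>2 * (a + c)\<close> or \<open>3 * a + c\<close> vanishes, and \<open>2 * (a - c)\<close> or
  \<open>3 * a - c\<close> vanishes. The two doubled terms cannot both vanish, nor can the two
  tripled ones, as their difference is \<open>2 * c\<close>. So one of each kind vanishes, with
  opposite signs at \<open>c\<close>, and twice the tripled term plus the doubled one is
  \<open>8 * a\<close>.\<close>

lemma closed_steps_arith:
  fixes N a c :: int
  defines "S \<equiv> {a, c, -a, -c}"
  assumes closed: "\<And>x y z. x \<in> S \<Longrightarrow> y \<in> S \<Longrightarrow> z \<in> S \<Longrightarrow> \<exists>p\<in>S. [x + y + z = p] (mod N)"
    and a: "\<not> [2 * a = 0] (mod N)" and c: "\<not> [2 * c = 0] (mod N)"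
    and ac: "\<not> [a = c] (mod N)" "\<not> [a = - c] (mod N)"
  shows "N dvd 8 * a" "\<not> N dvd 4 * a" "[c = 3 * a] (mod N) \<or> [c = - 3 * a] (mod N)"
proof -
  note lin = dvd_linear_combination[of N]
  have S: "a \<in> S" "c \<in> S" "-a \<in> S" "-c \<in> S"
    by (auto simp: S_def)
  have ex: "\<exists>p\<in>{a, c, -a, -c}. N dvd x + y + z - p" if "x \<in> S" "y \<in> S" "z \<in> S" for x y z
    using closed[OF that] by (simp add: S_def cong_iff_dvd_diff)
  have a: "\<not> N dvd 2 * a" and c: "\<not> N dvd 2 * c" and ac: "\<not> N dvd a - c" "\<not> N dvd a + c"
    using a c ac by (auto simp: cong_iff_dvd_diff)
  have 1: "N dvd 2 * (a + c) \<or> N dvd 3 * a + c"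
    using ex[OF S(1,1,2)] a ac by (auto simp: algebra_simps)
  have 2: "N dvd 2 * (a - c) \<or> N dvd 3 * a - c"
    using ex[OF S(1,1,4)] a ac by (auto simp: algebra_simps)
  have 3: "N dvd 2 * (a + c) \<or> N dvd 3 * c + a"
    using ex[OF S(2,2,1)] c ac by (auto simp: algebra_simps)
  have 4: "N dvd 2 * (a - c) \<or> N dvd 3 * c - a"
    using ex[OF S(2,2,3)] c ac lin[of "2 * (c - a)" 0 "2 * (a - c)" "-1" 0]
      lin[of "c - a" 0 "a - c" "-1" 0] by (auto simp: algebra_simps)
  \<comment> \<open>Both a + c and a - c would be the element N/2 of order 2, so their sum 2a would
    vanish. In integers: \<open>u\<close> and \<open>v\<close> are odd, so \<open>u + v\<close> is
    even and \<open>4 * a = N * (u + v)\<close> can be halved.\<close>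
  have 5: "\<not> (N dvd 2 * (a + c) \<and> N dvd 2 * (a - c))"
  proof
    assume *: "N dvd 2 * (a + c) \<and> N dvd 2 * (a - c)"
    then obtain u v where uv: "2 * (a + c) = N * u" "2 * (a - c) = N * v"
      by (auto elim!: dvdE)
    have "odd u"
    proof
      assume "even u"
      then have "a + c = N * (u div 2)"
        using uv(1) by (auto elim!: evenE)
      then show False
        using ac(2) by simp
    qed
    moreover have "odd v"
    proof
      assume "even v"
      then have "a - c = N * (v div 2)"
        using uv(2) by (auto elim!: evenE)
      then show False
        using ac(1) by simp
    qed
    ultimately obtain t where "u + v = 2 * t"
      by (metis evenE odd_even_add)
    moreover have "4 * a = N * (u + v)"
      using uv by (simp add: distrib_left)
    ultimately have "2 * a = N * t"
      by simp
    then show False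
      using a by simp
  qed
  have 6: "N dvd 3 * a + c \<or> N dvd 3 * a - c"
    using 1 2 5 by blast
  have 7: "\<not> (N dvd 3 * a + c \<and> N dvd 3 * a - c)"
    using lin[of "3 * a + c" "3 * a - c" "2 * c" 1 "-1"] c by auto
  show "N dvd 8 * a"
  proof (cases "N dvd 3 * a + c")
    case True
    then have "N dvd 2 * (a - c)"
      using 2 7 by blast
    with True show ?thesis
      by (rule lin[where i = 2 and j = 1]) simp
  next
    case False
    then have "N dvd 2 * (a + c)" "N dvd 3 * a - c"
      using 1 6 by blast+
    then show ?thesis
      by (rule lin[where i = 1 and j = 2]) simp
  qed
  \<comment> \<open>If \<open>4 * a\<close> vanished, then \<open>3 * a\<close> would be
    \<open>- a\<close>, and the tripled relation would say that \<open>a\<close> is \<open>c\<close>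
    or \<open>- c\<close>.\<close>
  show "\<not> N dvd 4 * a"
    using 6 lin[of "4 * a" "3 * a + c" "a - c" 1 "-1"] lin[of "4 * a" "3 * a - c" "a + c" 1 "-1"] ac
    by auto
  show "[c = 3 * a] (mod N) \<or> [c = - 3 * a] (mod N)"
    using 6 lin[of "3 * a - c" 0 "c - 3 * a" "-1" 0] by (auto simp: cong_iff_dvd_diff add.commute)
qed

section \<open>Star graphs of alternating cyclic presentations\<close>

text \<open>Subscripts are integers, so that \<open>-\<close> is not truncated, and signs are Booleans.\<close>

definition sletter :: "nat \<Rightarrow> bool \<Rightarrow> int \<Rightarrow> nat letter" where
  "sletter n s k = (if s then Gen else Inv) (nat (k mod int n))"

text \<open>With differences as parameters, a shift changes only \<open>k\<close>, and a rotation
  flips the sign and cycles the four differences, the fourth being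
  \<open>- (p + q + r)\<close>.\<close>

definition alt_word :: "nat \<Rightarrow> bool \<Rightarrow> int \<Rightarrow> int \<Rightarrow> int \<Rightarrow> int \<Rightarrow> nat word" where
  "alt_word n s k p q r =
     [sletter n s k, sletter n (\<not> s) (k + p), sletter n s (k + p + q), sletter n (\<not> s) (k + p + q + r)]"

lemma sletter_eq_iff:
  "n > 0 \<Longrightarrow> sletter n s k = sletter n t l \<longleftrightarrow> s = t \<and> [k = l] (mod int n)"
  by (auto simp: sletter_def cong_def nat_eq_iff)

lemma letter_inv_sletter [simp]: "letter_inv (sletter n s k) = sletter n (\<not> s) k"
  by (simp add: sletter_def)

lemma letters_eq_sletter: "n > 0 \<Longrightarrow> letters {..<n} = {sletter n s k | s k. True}"
proof (intro equalityI subsetI)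
  fix x assume "x \<in> letters {..<n}"
  then obtain i where i: "i < n" "x = Gen i \<or> x = Inv i"
    by (auto simp: letters_def)
  then have "x = sletter n True (int i) \<or> x = sletter n False (int i)"
    by (auto simp: sletter_def)
  then show "x \<in> {sletter n s k | s k. True}"
    by blast
qed (auto simp: sletter_def letters_def nat_less_iff)

lemma shift_word_alt_word:
  assumes "n > 0"
  shows "shift_word n (alt_word n s k p q r) = alt_word n s (k + 1) p q r"
proof -
  have "map_letter (\<lambda>i. (i + 1) mod n) (sletter n s k) = sletter n s (k + 1)" for s k
  proof -
    have "int ((nat (k mod int n) + 1) mod n) = (k + 1) mod int n"
      using assms by (simp add: zmod_int mod_simps add.commute)
    then show ?thesis
      by (auto simp: sletter_def simp flip: nat_int)
  qed
  then show ?thesis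
    by (simp add: shift_word_def alt_word_def add_ac)
qed

lemma alt_word_cong: "n > 0 \<Longrightarrow> [k = l] (mod int n) \<Longrightarrow> alt_word n s k p q r = alt_word n s l p q r"
  by (simp add: alt_word_def sletter_eq_iff cong_add_rcancel)

text \<open>Since subscripts are read mod \<open>n\<close>, \<open>k\<close> may range over all
  integers. Without a bound on \<open>k\<close>, any change of starting point is a mere
  substitution.\<close>

lemma rels_cyclic_presentation_alt_word:
  assumes "n > 0"
  shows "rels (cyclic_presentation n (alt_word n s 0 p q r)) = {alt_word n s k p q r | k. True}"
proof -
  have shift: "(shift_word n ^^ j) (alt_word n s 0 p q r) = alt_word n s (int j) p q r" for j
    by (induction j) (simp_all add: shift_word_alt_word[OF assms] add.commute)
  have "alt_word n s k p q r = alt_word n s (int (nat (k mod int n))) p q r" for k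
    using assms by (intro alt_word_cong) (simp_all add: cong_def)
  moreover have "nat (k mod int n) < n" for k
    using assms by (simp add: nat_less_iff)
  ultimately have "\<exists>j<n. alt_word n s k p q r = alt_word n s (int j) p q r" for k
    by blast
  moreover have "rels (cyclic_presentation n (alt_word n s 0 p q r)) = {alt_word n s (int j) p q r | j. j < n}"
    by (simp add: cyclic_presentation_def shift)
  ultimately show ?thesis
    by blast
qed

lemma rotate1_alt_word:
  "rotate1 (alt_word n s k p q r) = alt_word n (\<not> s) (k + p) q r (- (p + q + r))"
  by (simp add: alt_word_def)

lemma word_inv_alt_word:
  "word_inv (alt_word n s k p q r) = alt_word n s (k + p + q + r) (- r) (- q) (- p)"
  by (simp add: alt_word_def word_inv_def)

text \<open>\<open>b2\<close> is the difference from the last subscript back to the first. Around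
  the relator, \<open>a1\<close> and \<open>a2\<close> are the differences that leave positive
  letters, \<open>b1\<close> and \<open>b2\<close> those that leave negative ones.\<close>

locale alternating =
  fixes n :: nat and a1 b1 a2 b2 :: int and P :: "nat presentation"
  assumes n_pos: "n > 0"
    and sum_zero: "b2 = - (a1 + b1 + a2)"
    and gens: "gens P = {..<n}"
    and rels: "rels P = {alt_word n True k a1 b1 a2 | k. True}"
begin

abbreviation "x \<equiv> sletter n"
abbreviation "\<Gamma> \<equiv> star_graph P"

text \<open>
  A tuple \<open>(s, p, q, r)\<close> stands for the words \<open>alt_word n s k p q r\<close>, \<open>k \<in> \<int>\<close>. The eight tuples are
  the four rotations of the relator and of its inverse.
\<close>

definition types :: "(bool \<times> int \<times> int \<times> int) set" where
  "types = {(True, a1, b1, a2), (True, a2, b2, a1), (True, - a2, - b1, - a1), (True, - a1, - b2, - a2),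
     (False, b1, a2, b2), (False, b2, a1, b1), (False, - b1, - a1, - b2), (False, - b2, - a2, - b1)}"

text \<open>These are the first differences of the tuples of sign \<open>s\<close>, that is, the
  displacements along edges. They stay within one sign because the second letter of a word is read
  inverted.\<close>

definition steps :: "bool \<Rightarrow> int set" where
  "steps s = (if s then {a1, a2, - a1, - a2} else {b1, b2, - b1, - b2})"

lemma steps_iff: "p \<in> steps s \<longleftrightarrow> (\<exists>q r. (s, p, q, r) \<in> types)"
  by (auto simp: steps_def types_def)

lemma types_rotate: "(s, p, q, r) \<in> types \<Longrightarrow> (\<not> s, q, r, - (p + q + r)) \<in> types"
proof -
  have sums: "- (a1 + b1 + a2) = b2" "- (b1 + a2 + b2) = a1" "- (a2 + b2 + a1) = b1" "- (b2 + a1 + b1) = a2"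
    "- (- a2 + - b1 + - a1) = - b2" "- (- b1 + - a1 + - b2) = - a2"
    "- (- a1 + - b2 + - a2) = - b1" "- (- b2 + - a2 + - b1) = - a1"
    using sum_zero by linarith+
  have "\<forall>(s, p, q, r)\<in>types. (\<not> s, q, r, - (p + q + r)) \<in> types"
    unfolding types_def by (simp only: ball_simps prod.case sums insert_iff prod.inject simp_thms)
  then show "(s, p, q, r) \<in> types \<Longrightarrow> (\<not> s, q, r, - (p + q + r)) \<in> types"
    by auto
qed

lemma symmetrized_rels_eq:
  "symmetrized_rels P = {alt_word n s k p q r | s k p q r. (s, p, q, r) \<in> types}" (is "_ = ?W")
proof (intro equalityI subsetI)
  fix w assume "w \<in> symmetrized_rels P"
  then obtain i r where w: "w = rotate i r" and r: "r \<in> rels P \<union> word_inv ` rels P"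
    by (auto simp: symmetrized_rels_def)
  have types: "(True, a1, b1, a2) \<in> types" "(True, - a2, - b1, - a1) \<in> types"
    by (simp_all add: types_def)
  from r consider k where "r = alt_word n True k a1 b1 a2" | k where "r = word_inv (alt_word n True k a1 b1 a2)"
    unfolding rels by blast
  then have "r \<in> ?W"
    using types unfolding word_inv_alt_word by cases blast+
  moreover have "rotate1 v \<in> ?W" if v: "v \<in> ?W" for v
  proof -
    obtain s k p q r where "v = alt_word n s k p q r" "(s, p, q, r) \<in> types"
      using v by blast
    then show ?thesis
      using types_rotate[of s p q r] rotate1_alt_word[of n s k p q r] by blast
  qed
  ultimately have "(rotate1 ^^ i) r \<in> ?W"
    by (induction i) auto
  then show "w \<in> ?W"
    by (simp add: w rotate_def)
next
  let ?S = "symmetrized_rels P"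
  have rotate1: "rotate1 v \<in> ?S" if v: "v \<in> ?S" for v
  proof -
    obtain i r where "v = rotate i r" "r \<in> rels P \<union> word_inv ` rels P"
      using v unfolding symmetrized_rels_def by blast
    moreover from this have "rotate1 v = rotate (Suc i) r"
      by simp
    ultimately show ?thesis
      unfolding symmetrized_rels_def by blast
  qed
  have shift: "\<forall>k. alt_word n (\<not> s) k q r t \<in> ?S"
    if "\<forall>k. alt_word n s k p q r \<in> ?S" "t = - (p + q + r)" for s p q r t
  proof
    fix k
    show "alt_word n (\<not> s) k q r t \<in> ?S"
      using rotate1[OF that(1)[rule_format, of "k - p"]] that(2) by (simp add: rotate1_alt_word)
  qed
  have "rotate 0 r \<in> ?S" if "r \<in> rels P \<union> word_inv ` rels P" for r
    using that unfolding symmetrized_rels_def by blast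
  then have 0: "r \<in> ?S" if "r \<in> rels P \<union> word_inv ` rels P" for r
    using that by simp
  have 1: "\<forall>k. alt_word n True k a1 b1 a2 \<in> ?S"
    using 0 rels by blast
  \<comment> \<open>The inverse begins at the last subscript of the original word, so the start is
    moved back by the three differences.\<close>
  have "alt_word n True k (- a2) (- b1) (- a1) = word_inv (alt_word n True (k - a1 - b1 - a2) a1 b1 a2)" for k
    by (simp add: word_inv_alt_word)
  then have 5: "\<forall>k. alt_word n True k (- a2) (- b1) (- a1) \<in> ?S"
    using 0 rels by blast
  have "a1 = - (b1 + a2 + b2)" "b1 = - (a2 + b2 + a1)" "- b2 = - (- a2 + - b1 + - a1)"
    "- a2 = - (- b1 + - a1 + - b2)" "- b1 = - (- a1 + - b2 + - a2)"
    using sum_zero by linarith+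
  note sums = sum_zero this
  \<comment> \<open>Facts 2, 3, 4 are the rotations of fact 1, the relator; facts 6, 7, 8 are those
    of fact 5, its inverse. The entries of \<open>sums\<close> supply the fourth
    differences.\<close>
  note 2 = shift[OF 1 sums(1)] and 6 = shift[OF 5 sums(4)]
  note 3 = shift[OF 2 sums(2)] and 7 = shift[OF 6 sums(5)]
  note 4 = shift[OF 3 sums(3)] and 8 = shift[OF 7 sums(6)]
  have all: "\<forall>(s, p, q, r)\<in>types. \<forall>k. alt_word n s k p q r \<in> ?S"
    unfolding types_def using 1 2 3 4 5 6 7 8 by simp
  fix w assume "w \<in> ?W"
  then obtain s k p q r where "w = alt_word n s k p q r" "(s, p, q, r) \<in> types"
    by blast
  then show "w \<in> ?S"
    using all by auto
qed

text \<open>The second word is the inverse of the first, rotated to start at the other end of the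
  edge, written again with differences.\<close>

definition edge :: "bool \<Rightarrow> int \<Rightarrow> int \<Rightarrow> int \<Rightarrow> int \<Rightarrow> nat word set" where
  "edge s k p q r = {alt_word n s k p q r, alt_word n s (k + p) (- p) (p + q + r) (- r)}"

lemma edges_star_graph: "edges \<Gamma> = {edge s k p q r | s k p q r. (s, p, q, r) \<in> types}"
proof -
  have *: "(y # letter_inv z # u = alt_word n s k p q r) \<longleftrightarrow>
      y = x s k \<and> z = x s (k + p) \<and> u = [x s (k + p + q), x (\<not> s) (k + p + q + r)]" for y z u s k p q r
    by (auto simp: alt_word_def) (metis letter_inv_letter_inv letter_inv_sletter)+
  have e: "edge s k p q r = {y # letter_inv z # u, z # letter_inv y # word_inv u}"
    if "y = x s k" "z = x s (k + p)" "u = [x s (k + p + q), x (\<not> s) (k + p + q + r)]" for y z u s k p q r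
    using that by (simp add: edge_def alt_word_def word_inv_def algebra_simps)
  have "edges \<Gamma> = {{y # letter_inv z # u, z # letter_inv y # word_inv u} | y z u.
      \<exists>s k p q r. y # letter_inv z # u = alt_word n s k p q r \<and> (s, p, q, r) \<in> types}"
    by (simp add: star_graph_def symmetrized_rels_eq)
  also have "\<dots> = {edge s k p q r | s k p q r. (s, p, q, r) \<in> types}"
    unfolding * using e by blast
  finally show ?thesis .
qed

lemma edge_in_star_graph: "(s, p, q, r) \<in> types \<Longrightarrow> edge s k p q r \<in> edges \<Gamma>"
  unfolding edges_star_graph by blast

lemma verts_star_graph: "verts \<Gamma> = {x s k | s k. True}"
  by (simp add: star_graph_def gens letters_eq_sletter[OF n_pos])

lemma sletter_vertex [simp]: "x s k \<in> verts \<Gamma>"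
  unfolding verts_star_graph by blast

lemma ends_edge [simp]: "ends \<Gamma> (edge s k p q r) = {x s k, x s (k + p)}"
  by (simp add: star_graph_def edge_def alt_word_def)

lemma walk_step:
  assumes "p \<in> steps s"
  shows "\<exists>e. walk \<Gamma> (x s k) [e] (x s (k + p))"
proof -
  obtain q r where "(s, p, q, r) \<in> types"
    using assms by (auto simp: steps_iff)
  then have "walk \<Gamma> (x s k) [edge s k p q r] (x s (k + p))"
    unfolding walk.simps edges_star_graph verts_star_graph ends_edge by blast
  then show ?thesis ..
qed

lemma uminus_steps: "p \<in> steps s \<Longrightarrow> - p \<in> steps s"
  by (auto simp: steps_def split: if_splits)

lemma edge_between_iff:
  assumes "e \<in> edges \<Gamma>" "ends \<Gamma> e = {x s k, x s l}"
  shows "\<exists>p\<in>steps s. [l - k = p] (mod int n)"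
proof -
  obtain t m p q r where p: "(t, p, q, r) \<in> types" "e = edge t m p q r"
    using assms by (auto simp: edges_star_graph)
  then have "{x t m, x t (m + p)} = {x s k, x s l}"
    using assms by simp
  then have "t = s" "[m = k] (mod int n) \<and> [m + p = l] (mod int n) \<or>
      [m = l] (mod int n) \<and> [m + p = k] (mod int n)"
    by (auto simp: doubleton_eq_iff sletter_eq_iff[OF n_pos])
  then have "[l - k = p] (mod int n) \<or> [l - k = - p] (mod int n)"
    using dvd_linear_combination[of "int n" "m - k" "m + p - l" "l - k - p" 1 "-1"]
      dvd_linear_combination[of "int n" "m + p - k" "m - l" "l - k + p" 1 "-1"]
    by (auto simp: cong_iff_dvd_diff)
  moreover have "p \<in> steps s"
    using p \<open>t = s\<close> by (auto simp: steps_iff)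
  ultimately show ?thesis
    using uminus_steps by blast
qed

section \<open>Necessity: the steps in a special component\<close>

lemma no_loop:
  assumes "bipartite (component \<Gamma> (x s 0))" "p \<in> steps s"
  shows "\<not> [p = 0] (mod int n)"
proof
  assume p: "[p = 0] (mod int n)"
  obtain e where e: "walk \<Gamma> (x s 0) [e] (x s p)"
    using walk_step[OF assms(2), of 0] by auto
  have "x s 0 \<in> verts (component \<Gamma> (x s 0))"
    by (auto simp: component_def intro!: exI[of _ "[]"])
  then have "walk (component \<Gamma> (x s 0)) (x s 0) [e] (x s p)"
    by (rule component_walk[OF e])
  moreover have "x s p = x s 0"
    using p by (simp add: sletter_eq_iff[OF n_pos])
  ultimately show False
    using assms(1) unfolding bipartite_def by (fastforce simp: doubleton_eq_iff)
qed

text \<open>\<open>a\<close> and \<open>c\<close> are opposite differences of a relator, so the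
  pairs \<open>a1\<close>, \<open>a2\<close> and \<open>b1\<close>, \<open>b2\<close> are handled by
  one argument. The graph conditions are translated into the hypotheses of
  \<open>closed_steps_arith\<close>.\<close>

lemma special_component_steps:
  fixes C
  assumes C: "C = component \<Gamma> (x s 0)"
    and "bipartite C" and "diameter C = enat 2" "girth C = enat 4" "3 \<le> degree C (x s 0)"
    and T: "(s, a, q, c) \<in> types" "(s, c, q', a) \<in> types"
    and S: "steps s = {a, c, - a, - c}"
  shows "int n dvd 8 * a" "\<not> int n dvd 4 * a" "[c = 3 * a] (mod int n) \<or> [c = - 3 * a] (mod int n)"
proof -
  note eq = sletter_eq_iff[OF n_pos]
  note no_loop = no_loop[OF \<open>bipartite C\<close>[unfolded C]]
  have V: "x s 0 \<in> verts C"
    by (auto simp: C component_def intro!: exI[of _ "[]"])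
  have edges_C: "edges C \<subseteq> edges \<Gamma>" and ends_C: "ends C = ends \<Gamma>"
    by (auto simp: C component_def)
  have closed: "\<exists>p\<in>{a, c, - a, - c}. [p1 + p2 + p3 = p] (mod int n)"
    if p: "p1 \<in> {a, c, - a, - c}" "p2 \<in> {a, c, - a, - c}" "p3 \<in> {a, c, - a, - c}" for p1 p2 p3
  proof -
    obtain e1 e2 e3 where "walk \<Gamma> (x s 0) [e1] (x s p1)" "walk \<Gamma> (x s p1) [e2] (x s (p1 + p2))"
      "walk \<Gamma> (x s (p1 + p2)) [e3] (x s (p1 + p2 + p3))"
      using walk_step[of p1 s 0] walk_step[of p2 s p1] walk_step[of p3 s "p1 + p2"] p unfolding S by auto
    then have "walk \<Gamma> (x s 0) ([e1] @ [e2] @ [e3]) (x s (p1 + p2 + p3))"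
      by (meson walk_append)
    then have "walk C (x s 0) [e1, e2, e3] (x s (p1 + p2 + p3))"
      using component_walk V unfolding C by (simp del: walk.simps)
    then have "\<exists>e\<in>edges C. ends C e = {x s 0, x s (p1 + p2 + p3)}"
      by (rule bipartite_diameter_2_edge[OF assms(2) eq_refl[OF assms(3)]]) simp
    then show ?thesis
      using edge_between_iff[of _ s 0 "p1 + p2 + p3"] edges_C ends_C S by auto
  qed
  have parallel: "e = e'"
    if "e \<in> edges C" "e' \<in> edges C" "ends \<Gamma> e = {u, v}" "ends \<Gamma> e' = {u, v}" "u \<in> verts C" "v \<in> verts C"
    for e e' u v
    using parallel_edges_girth[of e C e' u v] that assms(4) ends_C by simp
  have end_edge: "\<exists>p\<in>steps s. ends \<Gamma> e = {x s 0, x s p}" if e_in: "e \<in> edges \<Gamma>" "x s 0 \<in> ends \<Gamma> e" for e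
  proof -
    obtain t k p q r where "(t, p, q, r) \<in> types" and e: "e = edge t k p q r"
      using e_in(1) unfolding edges_star_graph by blast
    then have p: "p \<in> steps t"
      by (auto simp: steps_iff)
    have "t = s" and "[k = 0] (mod int n) \<or> [k + p = 0] (mod int n)"
      using e_in(2) e by (auto simp: eq cong_sym_eq)
    moreover have "[k = - p] (mod int n)" if "[k + p = 0] (mod int n)"
      using that by (simp add: cong_iff_dvd_diff)
    ultimately have "ends \<Gamma> e = {x s 0, x s p} \<or> ends \<Gamma> e = {x s 0, x s (- p)}"
      using e by (auto simp: doubleton_eq_iff eq cong_iff_dvd_diff)
    then show ?thesis
      using p \<open>t = s\<close> uminus_steps by blast
  qed
  \<comment> \<open>With no loops and no parallel edges the degree counts distinct neighbours, and
    every neighbour is reached by a step.\<close>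
  have deg: "3 \<le> card (x s ` steps s)"
  proof -
    let ?E = "{e \<in> edges C. x s 0 \<in> ends C e}"
    have "ends C e \<noteq> {x s 0}" if e: "e \<in> edges C" for e
    proof
      assume "ends C e = {x s 0}"
      moreover from this obtain p where "p \<in> steps s" "ends \<Gamma> e = {x s 0, x s p}"
        using end_edge[of e] e edges_C ends_C by auto
      ultimately have "x s p = x s 0"
        using ends_C by (simp add: insert_eq_iff)
      then show False
        using no_loop[OF \<open>p \<in> steps s\<close>] by (simp add: eq)
    qed
    then have "{e \<in> edges C. ends C e = {x s 0}} = {}"
      by blast
    then have "degree C (x s 0) = card ?E"
      by (simp only: degree_def card.empty add_0_right)
    also have "\<dots> = card (ends \<Gamma> ` ?E)"
    proof (rule card_image[symmetric], rule inj_onI)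
      fix e e' assume e: "e \<in> ?E" "e' \<in> ?E" "ends \<Gamma> e = ends \<Gamma> e'"
      obtain p where "ends \<Gamma> e = {x s 0, x s p}"
        using end_edge[of e] e edges_C ends_C by auto
      moreover have "ends \<Gamma> e \<subseteq> verts C"
        using e by (auto simp: C component_def)
      ultimately show "e = e'"
        using parallel[of e e' "x s 0" "x s p"] e by auto
    qed
    also have "\<dots> \<le> card ((\<lambda>v. {x s 0, v}) ` (x s ` steps s))"
    proof (rule card_mono)
      show "ends \<Gamma> ` ?E \<subseteq> (\<lambda>v. {x s 0, v}) ` (x s ` steps s)"
        using end_edge edges_C ends_C by fastforce
    qed (simp add: S)
    also have "\<dots> \<le> card (x s ` steps s)"
      by (rule card_image_le) (simp add: S)
    finally show ?thesis
      using assms(5) by simp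
  qed
  \<comment> \<open>If \<open>a\<close> and \<open>c\<close> agreed up to sign, there would be at
    most two neighbours.\<close>
  have ac: "\<not> [a = c] (mod int n)" "\<not> [a = - c] (mod int n)"
  proof -
    have False if "x s ` steps s \<subseteq> {x s a, x s (- a)}"
    proof -
      have "card (x s ` steps s) \<le> card {x s a, x s (- a)}"
        using that by (intro card_mono) auto
      also have "\<dots> \<le> 2"
        by (simp add: card_insert_if)
      finally show False
        using deg by simp
    qed
    moreover have "[- a = - c] (mod int n)" if "[a = c] (mod int n)"
      using that by (simp add: cong_minus_minus_iff)
    moreover have "[- a = c] (mod int n)" if "[a = - c] (mod int n)"
      using cong_minus_minus_iff[of a "- c"] that by simp
    ultimately show "\<not> [a = c] (mod int n)" "\<not> [a = - c] (mod int n)"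
      by (auto simp: S eq cong_sym_eq)
  qed
  \<comment> \<open>If \<open>2 * a = 0\<close>, the edges leaving 0 and \<open>a\<close> by the
    step \<open>a\<close> have the same ends, so by the girth they are one edge. Either their first
    words coincide, and \<open>a\<close> is a loop, or each is the reversed form of the other, and
    comparing third subscripts gives \<open>a = - c\<close>.\<close>
  have double: "\<not> [2 * a = 0] (mod int n)"
    if T: "(s, a, q, c) \<in> types" and ac: "\<not> [a = - c] (mod int n)" for a q c
  proof
    assume 2: "[2 * a = 0] (mod int n)"
    have a: "a \<in> steps s"
      using T by (auto simp: steps_iff)
    have E: "edge s 0 a q c \<in> edges \<Gamma>" "edge s a a q c \<in> edges \<Gamma>"
      using T by (rule edge_in_star_graph)+
    have "x s (a + a) = x s 0"
      using 2 by (simp add: eq)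
    then have ends: "ends \<Gamma> (edge s 0 a q c) = {x s 0, x s a}" "ends \<Gamma> (edge s a a q c) = {x s 0, x s a}"
      by auto
    have "walk \<Gamma> (x s 0) [edge s 0 a q c] (x s a)"
      using E(1) ends(1) by auto
    then have Va: "x s a \<in> verts C"
      unfolding C component_def by (simp del: walk.simps) blast
    have "edge s 0 a q c \<in> edges C" "edge s a a q c \<in> edges C"
      using E ends V Va by (auto simp: C component_def)
    then have "edge s 0 a q c = edge s a a q c"
      using parallel ends V Va by metis
    then have "alt_word n s 0 a q c \<in> edge s a a q c"
      by (auto simp: edge_def)
    moreover have "alt_word n s 0 a q c \<noteq> alt_word n s a a q c"
      using no_loop[OF a] by (simp add: alt_word_def eq cong_sym_eq)
    ultimately have "alt_word n s 0 a q c = alt_word n s (a + a) (- a) (a + q + c) (- c)"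
      by (auto simp: edge_def)
    then have "[a + q = a + a + - a + (a + q + c)] (mod int n)"
      by (simp add: alt_word_def eq)
    then have "int n dvd - (a + c)"
      by (simp add: cong_iff_dvd_diff)
    then show False
      using ac by (simp only: dvd_minus_iff cong_iff_dvd_diff) simp
  qed
  have ca: "\<not> [c = - a] (mod int n)"
    using ac(2) by (simp add: cong_iff_dvd_diff add.commute)
  show "int n dvd 8 * a" "\<not> int n dvd 4 * a" "[c = 3 * a] (mod int n) \<or> [c = - 3 * a] (mod int n)"
    using closed_steps_arith[OF closed double[OF T(1) ac(2)] double[OF T(2) ca] ac] by blast+
qed

text \<open>The second word of an edge also belongs to a listed type, so an edge can be described
  from either end.\<close>

lemma types_flip: "(s, p, q, r) \<in> types \<Longrightarrow> (s, - p, p + q + r, - r) \<in> types"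
proof -
  have sums: "a1 + b1 + a2 = - b2" "a2 + b2 + a1 = - b1" "- a2 + - b1 + - a1 = b2" "- a1 + - b2 + - a2 = b1"
    "b1 + a2 + b2 = - a1" "b2 + a1 + b1 = - a2" "- b1 + - a1 + - b2 = a2" "- b2 + - a2 + - b1 = a1"
    using sum_zero by linarith+
  have "\<forall>(s, p, q, r)\<in>types. (s, - p, p + q + r, - r) \<in> types"
    unfolding types_def by (simp only: ball_simps prod.case sums insert_iff prod.inject simp_thms minus_minus)
  then show "(s, p, q, r) \<in> types \<Longrightarrow> (s, - p, p + q + r, - r) \<in> types"
    by auto
qed

lemma edge_flip: "edge s (k + p) (- p) (p + q + r) (- r) = edge s k p q r"
  by (simp add: edge_def insert_commute)

lemma edge_cong: "[k = l] (mod int n) \<Longrightarrow> edge s k p q r = edge s l p q r"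
  using alt_word_cong[OF n_pos, of k l] alt_word_cong[OF n_pos, of "k + p" "l + p"]
  by (simp add: edge_def cong_add_rcancel)

text \<open>Mod \<open>n\<close>, \<open>a2\<close> is a multiple of \<open>a1\<close>, so
  irreducibility makes the gcd of \<open>n\<close>, \<open>a1\<close> and \<open>b1\<close> equal to
  1. As \<open>n\<close> divides 8 times each of them, it divides 8; a proper divisor of 8 divides
  4, against \<open>4 * a1\<close> being nonzero mod \<open>n\<close>.\<close>

lemma special_imp:
  assumes special: "special 2 4 \<nu> P"
    and coprime: "\<And>d. d dvd int n \<Longrightarrow> d dvd a1 \<Longrightarrow> d dvd b1 \<Longrightarrow> d dvd a2 \<Longrightarrow> is_unit d"
  shows "n = 8" "odd a1" "odd b1" "[a2 = 3 * a1] (mod 8) \<or> [a2 = - 3 * a1] (mod 8)"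
    "[b2 = 3 * b1] (mod 8) \<or> [b2 = - 3 * b1] (mod 8)"
proof -
  have *: "bipartite (component \<Gamma> (x s 0))" "diameter (component \<Gamma> (x s 0)) = enat 2"
    "girth (component \<Gamma> (x s 0)) = enat 4" "3 \<le> degree (component \<Gamma> (x s 0)) (x s 0)" for s
  proof -
    have "component \<Gamma> (x s 0) \<in> components \<Gamma>"
      by (simp add: components_def)
    moreover have "x s 0 \<in> verts (component \<Gamma> (x s 0))"
      by (auto simp: component_def intro!: exI[of _ "[]"])
    ultimately show "bipartite (component \<Gamma> (x s 0))" "diameter (component \<Gamma> (x s 0)) = enat 2"
      "girth (component \<Gamma> (x s 0)) = enat 4" "3 \<le> degree (component \<Gamma> (x s 0)) (x s 0)"
      using special unfolding special_def by auto
  qed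
  have T: "(True, a1, b1, a2) \<in> types" "(True, a2, b2, a1) \<in> types"
    "(False, b1, a2, b2) \<in> types" "(False, b2, a1, b1) \<in> types"
    by (simp_all add: types_def)
  have a: "int n dvd 8 * a1" "\<not> int n dvd 4 * a1" "[a2 = 3 * a1] (mod int n) \<or> [a2 = - 3 * a1] (mod int n)"
    using special_component_steps[OF refl *[of True] T(1,2)] by (simp_all add: steps_def)
  have b: "int n dvd 8 * b1" "\<not> int n dvd 4 * b1" "[b2 = 3 * b1] (mod int n) \<or> [b2 = - 3 * b1] (mod int n)"
    using special_component_steps[OF refl *[of False] T(3,4)] by (simp_all add: steps_def)
  define g where "g = gcd (int n) (gcd a1 b1)"
  have "g dvd int n" "g dvd gcd a1 b1"
    unfolding g_def by (rule gcd_dvd1, rule gcd_dvd2)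
  then have "g dvd int n" "g dvd a1" "g dvd b1"
    by (meson dvd_trans gcd_dvd1 gcd_dvd2)+
  moreover have "g dvd a2"
  proof -
    have "g dvd a2 - 3 * a1 \<or> g dvd a2 - - 3 * a1"
      using a(3) dvd_trans[OF \<open>g dvd int n\<close>] unfolding cong_iff_dvd_diff by blast
    then show ?thesis
    proof
      assume "g dvd a2 - 3 * a1"
      then show ?thesis
        using \<open>g dvd a1\<close> by (rule dvd_linear_combination[where i = 1 and j = 3]) simp
    next
      assume "g dvd a2 - - 3 * a1"
      then show ?thesis
        using \<open>g dvd a1\<close> by (rule dvd_linear_combination[where i = 1 and j = "-3"]) simp
    qed
  qed
  ultimately have "is_unit g"
    using coprime by blast
  then have "g = 1"
    by (simp add: g_def)
  have "int n dvd gcd (8 * int n) (gcd (8 * a1) (8 * b1))"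
    using a(1) b(1) by simp
  also have "gcd (8 * int n) (gcd (8 * a1) (8 * b1)) = 8 * g"
    by (simp add: g_def gcd_mult_left)
  finally have n8: "int n dvd 8"
    by (simp add: \<open>g = 1\<close>)
  show "n = 8"
  proof (rule ccontr)
    assume "n \<noteq> 8"
    have "n dvd 8"
      using n8 by (metis int_dvd_int_iff of_nat_numeral)
    then have "n \<le> 8"
      by (rule dvd_imp_le) simp
    then have "n \<in> {0,1,2,3,4,5,6,7,8}"
      by auto
    then have "n dvd 4"
      using \<open>n dvd 8\<close> \<open>n \<noteq> 8\<close> by auto
    then have "int n dvd 4 * a1"
      by (metis dvd_mult2 int_dvd_int_iff of_nat_numeral)
    then show False
      using a(2) by simp
  qed
  then have n: "int n = 8"
    by simp
  have "odd i" if "\<not> 8 dvd 4 * i" for i :: int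
    using that by presburger
  then show "odd a1" "odd b1"
    using a(2) b(2) unfolding n by blast+
  show "[a2 = 3 * a1] (mod 8) \<or> [a2 = - 3 * a1] (mod 8)" "[b2 = 3 * b1] (mod 8) \<or> [b2 = - 3 * b1] (mod 8)"
    using a(3) b(3) unfolding n by blast+
qed

end

section \<open>Sufficiency for n = 8\<close>

locale alternating_octagon = alternating +
  assumes n: "n = 8"
    and odd_a1: "odd a1" and odd_b1: "odd b1"
    and a2: "[a2 = 3 * a1] (mod 8) \<or> [a2 = - 3 * a1] (mod 8)"
    and b2: "[b2 = 3 * b1] (mod 8) \<or> [b2 = - 3 * b1] (mod 8)"
begin

lemma x_eq_iff: "x s k = x t l \<longleftrightarrow> s = t \<and> [k = l] (mod 8)"
  using sletter_eq_iff[OF n_pos] by (simp add: n)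

lemma odd_steps: "p \<in> steps s \<Longrightarrow> odd p"
proof -
  have "odd c" if "odd a" "8 dvd c - 3 * a \<or> 8 dvd c - - 3 * a" for a c :: int
    using that by presburger
  then have "odd a2" "odd b2"
    using a2 b2 odd_a1 odd_b1 unfolding cong_iff_dvd_diff by blast+
  then show "p \<in> steps s \<Longrightarrow> odd p"
    using odd_a1 odd_b1 by (auto simp: steps_def split: if_splits)
qed

lemma steps_cover: "odd d \<Longrightarrow> \<exists>p\<in>steps s. [d = p] (mod 8)"
proof -
  have *: "8 dvd d - a \<or> 8 dvd d - c \<or> 8 dvd d - - a \<or> 8 dvd d - - c"
    if "odd a" "odd d" "8 dvd c - 3 * a \<or> 8 dvd c - - 3 * a" for a c d :: int
    using that by presburger
  assume "odd d"
  then show ?thesis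
    using *[of a1 d a2] *[of b1 d b2] a2 b2 odd_a1 odd_b1
    by (auto simp: steps_def cong_iff_dvd_diff)
qed

text \<open>The four tuples of each sign have incongruent first steps, so a vertex and a step
  determine the edge. This is what excludes parallel edges.\<close>

lemma types_unique:
  assumes "(s, p, q, r) \<in> types" "(s, p', q', r') \<in> types" "[p = p'] (mod 8)"
  shows "p = p'" "q = q'" "r = r'"
proof -
  \<comment> \<open>The twelve ordered pairs of distinct entries of a, c, -a, -c, each in the form
    in which the simplifier meets it below.\<close>
  have *: "\<not> 8 dvd a - c" "\<not> 8 dvd c - a" "\<not> 8 dvd a - - c" "\<not> 8 dvd c - - a" "\<not> 8 dvd a - - a"
    "\<not> 8 dvd c - - c" "\<not> 8 dvd - a - c" "\<not> 8 dvd - c - a" "\<not> 8 dvd - a - - c" "\<not> 8 dvd - c - - a"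
    "\<not> 8 dvd - a - a" "\<not> 8 dvd - c - c"
    if "odd a" "8 dvd c - 3 * a \<or> 8 dvd c - - 3 * a" for a c :: int
  proof -
    have "\<not> 8 dvd a - c" "\<not> 8 dvd a + c" "\<not> 8 dvd 2 * a" "\<not> 8 dvd 2 * c"
      using that by presburger+
    then show "\<not> 8 dvd a - c" "\<not> 8 dvd c - a" "\<not> 8 dvd a - - c" "\<not> 8 dvd c - - a" "\<not> 8 dvd a - - a"
      "\<not> 8 dvd c - - c" "\<not> 8 dvd - a - c" "\<not> 8 dvd - c - a" "\<not> 8 dvd - a - - c" "\<not> 8 dvd - c - - a"
      "\<not> 8 dvd - a - a" "\<not> 8 dvd - c - c"
      using dvd_diff_commute[of 8 "- c" a] dvd_minus_iff[of 8 "a - c"] dvd_minus_iff[of 8 "a + c"] dvd_minus_iff[of 8 "2 * a"]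
        dvd_minus_iff[of 8 "2 * c"] by (simp_all add: algebra_simps)
  qed
  note A = *[OF odd_a1 a2[unfolded cong_iff_dvd_diff]] and B = *[OF odd_b1 b2[unfolded cong_iff_dvd_diff]]
  have "\<forall>(s, p, q, r)\<in>types. \<forall>(s', p', q', r')\<in>types. s = s' \<longrightarrow> 8 dvd p - p' \<longrightarrow> p = p' \<and> q = q' \<and> r = r'"
    unfolding types_def
    by (simp only: ball_simps prod.case A B simp_thms)
  then show "p = p'" "q = q'" "r = r'"
    using assms by (auto simp: cong_iff_dvd_diff)
qed

lemma verts_component: "verts (component \<Gamma> (x s k)) = range (x s)"
proof (intro equalityI subsetI)
  have "v \<in> range (x s)" if "walk \<Gamma> u es v" "u \<in> range (x s)" for u es v
    using that
  proof (induction es arbitrary: u)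
    case (Cons e es)
    then obtain y where y: "e \<in> edges \<Gamma>" "ends \<Gamma> e = {u, y}" "walk \<Gamma> y es v"
      by auto
    then obtain t i p q r where "e = edge t i p q r"
      unfolding edges_star_graph by blast
    moreover from this have "u = x t i \<or> u = x t (i + p)" "y = x t i \<or> y = x t (i + p)"
      using y(2) by (auto simp: doubleton_eq_iff)
    moreover from this have "t = s"
      using Cons.prems(2) x_eq_iff by auto
    ultimately have "y \<in> range (x s)"
      by blast
    then show ?case
      using Cons.IH y(3) by blast
  qed auto
  then show "v \<in> range (x s)" if "v \<in> verts (component \<Gamma> (x s k))" for v
    using that by (auto simp: component_def)
next
  fix v assume "v \<in> range (x s)"
  then obtain i where v: "v = x s i"
    by blast
  have odd: "\<exists>e. walk \<Gamma> (x s j) [e] (x s i)" if d: "odd (i - j)" for i j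
  proof -
    obtain p where p: "p \<in> steps s" "[i - j = p] (mod 8)"
      using steps_cover[OF d] by blast
    then have "[i = j + p] (mod 8)"
      by (simp add: cong_iff_dvd_diff algebra_simps)
    then have "x s (j + p) = x s i"
      by (simp add: x_eq_iff cong_sym_eq)
    then show ?thesis
      using walk_step[OF p(1), of j] by simp
  qed
  have "\<exists>es. walk \<Gamma> (x s k) es (x s i)"
  proof (cases "odd (i - k)")
    case True
    then show ?thesis
      using odd by blast
  next
    case False
    \<comment> \<open>An even difference is a sum of two odd ones, split at
      \<open>k + 1\<close>.\<close>
    then obtain e e' where "walk \<Gamma> (x s k) [e] (x s (k + 1))" "walk \<Gamma> (x s (k + 1)) [e'] (x s i)"
      using odd[of "k + 1" k] odd[of i "k + 1"] by auto
    then show ?thesis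
      by (blast intro: walk_append)
  qed
  then show "v \<in> verts (component \<Gamma> (x s k))"
    by (simp add: component_def v)
qed

lemma component_eq: "component \<Gamma> (x s k) = component \<Gamma> (x s 0)"
  using verts_component[of s k] verts_component[of s 0] by (simp add: component_def)

lemma edges_component:
  "edges (component \<Gamma> (x s k)) = {edge s i p q r | i p q r. (s, p, q, r) \<in> types}"
proof -
  have "edges (component \<Gamma> (x s k)) = {e \<in> edges \<Gamma>. ends \<Gamma> e \<subseteq> verts (component \<Gamma> (x s k))}"
    by (simp add: component_def)
  also have "\<dots> = {edge s i p q r | i p q r. (s, p, q, r) \<in> types}"
  proof -
    have "ends \<Gamma> (edge t i p q r) \<subseteq> range (x s) \<longleftrightarrow> t = s" for t i p q r
      using x_eq_iff by auto
    then have iff: "edge t i p q r \<in> {e \<in> edges \<Gamma>. ends \<Gamma> e \<subseteq> range (x s)} \<longleftrightarrow> t = s"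
      if "(t, p, q, r) \<in> types" for t i p q r
      using edge_in_star_graph[OF that] by simp
    show ?thesis
      unfolding verts_component
    proof (intro equalityI subsetI)
      fix e assume e: "e \<in> {e \<in> edges \<Gamma>. ends \<Gamma> e \<subseteq> range (x s)}"
      then obtain t i p q r where "e = edge t i p q r" "(t, p, q, r) \<in> types"
        unfolding edges_star_graph by blast
      then show "e \<in> {edge s i p q r | i p q r. (s, p, q, r) \<in> types}"
        using iff e by blast
    next
      fix e assume "e \<in> {edge s i p q r | i p q r. (s, p, q, r) \<in> types}"
      then obtain i p q r where "e = edge s i p q r" "(s, p, q, r) \<in> types"
        by blast
      then show "e \<in> {e \<in> edges \<Gamma>. ends \<Gamma> e \<subseteq> range (x s)}"
        using iff by blast
    qed
  qed
  finally show ?thesis .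
qed

lemma complete_bipartite_component:
  "complete_bipartite (component \<Gamma> (x s k)) (x s ` {i. even i}) (x s ` {i. odd i})"
  unfolding complete_bipartite_def
proof (intro conjI)
  let ?E = "{{a, b} | a b. a \<in> x s ` {i. even i} \<and> b \<in> x s ` {i. odd i}}"
  have parity: "even i \<longleftrightarrow> even j" if "[i = j] (mod 8)" for i j :: int
    using that unfolding cong_iff_dvd_diff by presburger
  show "verts (component \<Gamma> (x s k)) = x s ` {i. even i} \<union> x s ` {i. odd i}"
    unfolding verts_component by auto
  show "x s ` {i. even i} \<inter> x s ` {i. odd i} = {}"
    using parity by (auto simp: x_eq_iff)
  have ends: "ends (component \<Gamma> (x s k)) = ends \<Gamma>"
    by (simp add: component_def)
  show "bij_betw (ends (component \<Gamma> (x s k))) (edges (component \<Gamma> (x s k))) ?E"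
    unfolding bij_betw_def edges_component ends
  proof (rule conjI, rule inj_onI)
    fix e e'
    assume "e \<in> {edge s i p q r | i p q r. (s, p, q, r) \<in> types}"
      and "e' \<in> {edge s i p q r | i p q r. (s, p, q, r) \<in> types}" and eq: "ends \<Gamma> e = ends \<Gamma> e'"
    then obtain i p q r j p' q' r' where e: "(s, p, q, r) \<in> types" "e = edge s i p q r"
      and e': "(s, p', q', r') \<in> types" "e' = edge s j p' q' r'"
      by blast
    have "[i = j] (mod 8) \<and> [i + p = j + p'] (mod 8) \<or> [i = j + p'] (mod 8) \<and> [i + p = j] (mod 8)"
      using eq by (auto simp: e e' doubleton_eq_iff x_eq_iff)
    then show "e = e'"
    proof
      assume *: "[i = j] (mod 8) \<and> [i + p = j + p'] (mod 8)"
      then have "8 dvd p - p'"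
        using dvd_linear_combination[of 8 "i - j" "i + p - (j + p')" "p - p'" "-1" 1]
        by (simp add: cong_iff_dvd_diff)
      then have "p = p'" "q = q'" "r = r'"
        using types_unique[OF e(1) e'(1)] by (simp_all add: cong_iff_dvd_diff)
      then show ?thesis
        using * edge_cong[of i j] by (simp add: e e' n)
    next
      \<comment> \<open>The two descriptions run in opposite directions, so the second is rewritten
        from its other end before uniqueness of types applies.\<close>
      assume *: "[i = j + p'] (mod 8) \<and> [i + p = j] (mod 8)"
      then have "8 dvd p - - p'"
        using dvd_linear_combination[of 8 "i - (j + p')" "i + p - j" "p - - p'" "-1" 1]
        by (simp add: cong_iff_dvd_diff)
      then have "p = - p'" "q = p' + q' + r'" "r = - r'"
        using types_unique[OF e(1) types_flip[OF e'(1)]] by (simp_all add: cong_iff_dvd_diff)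
      then have "e = edge s i (- p') (p' + q' + r') (- r')"
        by (simp add: e)
      also have "\<dots> = edge s (j + p') (- p') (p' + q' + r') (- r')"
        using * by (intro edge_cong) (simp add: n)
      finally show ?thesis
        by (simp add: e' edge_flip)
    qed
  next
    show "ends \<Gamma> ` {edge s i p q r | i p q r. (s, p, q, r) \<in> types} = ?E"
    proof (intro equalityI subsetI)
      fix X assume "X \<in> ends \<Gamma> ` {edge s i p q r | i p q r. (s, p, q, r) \<in> types}"
      then obtain i p q r where "(s, p, q, r) \<in> types" and X: "X = {x s i, x s (i + p)}"
        by auto
      then have "odd p"
        using odd_steps by (auto simp: steps_iff)
      show "X \<in> ?E"
      proof (cases "even i")
        case True
        then show ?thesis
          using \<open>odd p\<close> X by (intro CollectI exI[of _ "x s i"] exI[of _ "x s (i + p)"]) auto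
      next
        case False
        then show ?thesis
          using \<open>odd p\<close> X by (intro CollectI exI[of _ "x s (i + p)"] exI[of _ "x s i"]) auto
      qed
    next
      fix X assume "X \<in> ?E"
      then obtain i j where X: "X = {x s i, x s j}" and ij: "odd (j - i)"
        by auto
      obtain p where p: "p \<in> steps s" "[j - i = p] (mod 8)"
        using steps_cover[OF ij] by blast
      then obtain q r where "(s, p, q, r) \<in> types"
        unfolding steps_iff by blast
      moreover have "x s (i + p) = x s j"
      proof -
        have "[j = i + p] (mod 8)"
          using p(2) by (simp add: cong_iff_dvd_diff algebra_simps)
        then show ?thesis
          by (simp add: x_eq_iff cong_sym_eq)
      qed
      ultimately show "X \<in> ends \<Gamma> ` {edge s i p q r | i p q r. (s, p, q, r) \<in> types}"
        using X by (intro image_eqI[of _ _ "edge s i p q r"]) auto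
    qed
  qed
qed

lemma finite_range_x: "finite (range (x s))"
proof -
  have "range (x s) \<subseteq> letters {..<n}"
    unfolding letters_eq_sletter[OF n_pos] by blast
  then show ?thesis
    by (rule finite_subset) (simp add: letters_def)
qed

lemma card_parity_class: "3 \<le> card (x s ` {i. even i})" "3 \<le> card (x s ` {i. odd i})"
proof -
  have "card {x s 0, x s 2, x s 4} \<le> card (x s ` {i. even i})"
    by (rule card_mono) (auto intro: finite_subset[OF _ finite_range_x])
  then show "3 \<le> card (x s ` {i. even i})"
    by (simp add: x_eq_iff cong_def)
  have "card {x s 1, x s 3, x s 5} \<le> card (x s ` {i. odd i})"
    by (rule card_mono) (auto intro: finite_subset[OF _ finite_range_x])
  then show "3 \<le> card (x s ` {i. odd i})"
    by (simp add: x_eq_iff cong_def)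
qed

lemma components_star_graph: "components \<Gamma> = {component \<Gamma> (x True 0), component \<Gamma> (x False 0)}"
proof -
  have "components \<Gamma> = {component \<Gamma> (x s k) | s k. True}"
    unfolding components_def verts_star_graph by blast
  also have "\<dots> = {component \<Gamma> (x s 0) | s. True}"
    using component_eq by blast
  also have "\<dots> = {component \<Gamma> (x True 0), component \<Gamma> (x False 0)}"
    by (auto intro: exI[of _ True] exI[of _ False]) (metis (full_types))
  finally show ?thesis .
qed

lemma card_components: "card (components \<Gamma>) = 2"
proof -
  have "x True 0 \<notin> range (x False)"
    by (auto simp: x_eq_iff)
  then have "verts (component \<Gamma> (x True 0)) \<noteq> verts (component \<Gamma> (x False 0))"
    unfolding verts_component by blast
  then have "component \<Gamma> (x True 0) \<noteq> component \<Gamma> (x False 0)"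
    by auto
  then show ?thesis
    by (simp add: components_star_graph)
qed

text \<open>Inverting letters exchanges the positive and the negative part and preserves parity of
  subscripts, which gives the isomorphism of the two components.\<close>

lemma bij_betw_letter_inv: "bij_betw letter_inv (x s ` I) (x (\<not> s) ` I)"
  by (rule bij_betw_byWitness[where f' = letter_inv]) auto

lemma components_isomorphic:
  "graph_isomorphic (component \<Gamma> (x s 0)) (component \<Gamma> (x t 0))"
proof (cases "s = t")
  case True
  then show ?thesis
    using complete_bipartite_isomorphic[OF complete_bipartite_component complete_bipartite_component
        bij_betw_id bij_betw_id] by simp
next
  case False
  then have "t = (\<not> s)"
    by simp
  then show ?thesis
    using complete_bipartite_isomorphic[OF complete_bipartite_component complete_bipartite_component
        bij_betw_letter_inv bij_betw_letter_inv] by simp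
qed

text \<open>All four differences are odd, so cyclically adjacent letters have subscripts of
  different parity and never cancel; \<open>b2\<close> accounts for the pair formed by the last and
  first letters.\<close>

lemma rels_carrier: "rels P \<subseteq> carrier (free_group (gens P))"
  and rels_cyclically_reduced: "r \<in> rels P \<Longrightarrow> cyclically_reduced r"
  and rels_length: "r \<in> rels P \<Longrightarrow> length r = 4"
proof -
  have odd: "odd a1" "odd b1" "odd a2" "odd b2"
    using odd_steps[of a1 True] odd_steps[of a2 True] odd_steps[of b1 False] odd_steps[of b2 False]
    by (simp_all add: steps_def)
  have "\<not> [p = 0] (mod 8)" if "odd p" for p :: int
    using that unfolding cong_iff_dvd_diff by presburger
  then have c: "\<not> [i = i + p] (mod 8)" "\<not> [i + p = i] (mod 8)" if "odd p" for i p :: int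
    using that by (simp_all add: cong_sym_eq[of i] cong_iff_dvd_diff)
  have *: "cyclically_reduced (alt_word n True k a1 b1 a2)" for k
  proof -
    have *: "k + a1 + b1 + a2 = k + - b2"
      using sum_zero by simp
    have "\<not> [k = k + a1 + b1 + a2] (mod 8)"
      unfolding * by (rule c(1)) (simp add: odd)
    then show ?thesis
      using c[of a1] c[of b1] c[of a2] odd
      by (simp add: cyclically_reduced_def reduced_def alt_word_def x_eq_iff)
  qed
  then show "r \<in> rels P \<Longrightarrow> cyclically_reduced r"
    by (auto simp: rels)
  show "r \<in> rels P \<Longrightarrow> length r = 4"
    by (auto simp: rels alt_word_def)
  have "x s k \<in> letters {..<n}" for s k
    unfolding letters_eq_sletter[OF n_pos] by blast
  then show "rels P \<subseteq> carrier (free_group (gens P))"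
    using * by (auto simp: rels gens free_group_def alt_word_def cyclically_reduced_def)
qed

lemma special: "special 2 4 2 P"
proof -
  have fin: "finite (gens P)"
    by (simp add: gens)
  have "rels P \<subseteq> {w. set w \<subseteq> letters (gens P) \<and> length w = 4}"
    using rels_carrier rels_length by (auto simp: free_group_def)
  then have "finite (rels P)"
    by (rule finite_subset) (simp add: fin finite_lists_length_eq letters_def)
  moreover have "connected_graph C \<and> bipartite C \<and> diameter C = enat 2 \<and> girth C = enat (2 * 2) \<and>
      (\<forall>v\<in>verts C. degree C v \<ge> 3)" if "C \<in> components \<Gamma>" for C
  proof -
    obtain s where C: "C = component \<Gamma> (x s 0)"
      using \<open>C \<in> components \<Gamma>\<close> components_star_graph by blast
    note cb = complete_bipartite_component[of s 0, folded C] card_parity_class[of s]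
    show ?thesis
      using complete_bipartite_connected[OF cb] complete_bipartite_bipartite[OF cb(1)]
        complete_bipartite_diameter[OF cb] complete_bipartite_girth[OF cb] complete_bipartite_degree[OF cb]
      by simp
  qed
  moreover have "graph_isomorphic C D" if "C \<in> components \<Gamma>" "D \<in> components \<Gamma>" for C D
    using that components_isomorphic unfolding components_star_graph by blast
  ultimately show ?thesis
    unfolding special_def
    using fin rels_carrier rels_cyclically_reduced card_components rels_length by simp
qed

end

section \<open>The eight-generator presentations\<close>

text \<open>Lists in place of sets make the conditions on relators executable.\<close>

definition relators :: "nat \<Rightarrow> nat word \<Rightarrow> nat word list" where
  "relators n w = map (\<lambda>j. (shift_word n ^^ j) w) [0..<n]"

lemma set_relators: "set (relators n w) = rels (cyclic_presentation n w)"
  by (auto simp: relators_def cyclic_presentation_def)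

definition letter_list :: "nat \<Rightarrow> nat letter list" where
  "letter_list n = map Gen [0..<n] @ map Inv [0..<n]"

lemma set_letter_list: "set (letter_list n) = letters {..<n}"
  by (auto simp: letter_list_def letters_def)

text \<open>For odd \<open>u\<close> and even \<open>d\<close> the subscript keeps its parity, and
  \<open>d\<close> moves the odd subscripts only. A relator starting at an even subscript becomes
  positive; one starting at an odd subscript becomes a word in inverses, hence the need to compare
  relators up to inversion.\<close>

definition signed_affine :: "nat \<Rightarrow> nat \<Rightarrow> nat letter \<Rightarrow> nat letter" where
  "signed_affine u d l =
     (case l of
        Gen m \<Rightarrow> (if even m then Gen else Inv) ((u * m + d * (m mod 2)) mod 8)
      | Inv m \<Rightarrow> (if even m then Inv else Gen) ((u * m + d * (m mod 2)) mod 8))"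

lemma signed_affine_letter_inv: "signed_affine u d (letter_inv l) = letter_inv (signed_affine u d l)"
  by (cases l) (auto simp: signed_affine_def)

definition rotations :: "nat word \<Rightarrow> nat word list" where
  "rotations u = map (\<lambda>i. rotate i u) [0..<length u] @ map (\<lambda>i. rotate i (word_inv u)) [0..<length u]"

text \<open>An executable form of the hypotheses of \<open>presented_group_iso\<close>. Surjectivity
  is not tested: an injective map of a finite set into itself is onto.\<close>

definition octagon_check :: "nat \<Rightarrow> nat \<Rightarrow> nat word \<Rightarrow> nat word \<Rightarrow> bool" where
  "octagon_check u d v w \<longleftrightarrow>
     (let h = signed_affine u d; L = letter_list 8; R = relators 8 v; Q = relators 8 w
      in distinct (map h L) \<and> list_all (\<lambda>l. List.member L (h l)) L \<and>
         list_all (\<lambda>r. reduced r \<and> list_all (List.member L) r) (R @ Q) \<and>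
         list_all (\<lambda>r. list_ex (\<lambda>q. List.member (rotations q) (map h r)) Q) R \<and>
         list_all (\<lambda>q. list_ex (\<lambda>r. List.member (rotations (map h r)) q) R) Q)"

lemma octagon_check_iso:
  assumes "octagon_check u d v w"
  shows "cyclic_group 8 v \<cong> cyclic_group 8 w"
  unfolding cyclic_group_def
proof (rule presented_group_iso[where h = "signed_affine u d"])
  let ?h = "signed_affine u d"
  have gens: "gens (cyclic_presentation 8 v) = {..<8}" "gens (cyclic_presentation 8 w) = {..<8}"
    by (simp_all add: cyclic_presentation_def)
  have rotations: "r' \<in> set (rotations r) \<Longrightarrow> cyclically_equivalent r r'" for r r'
    by (auto simp: rotations_def cyclically_equivalent_def)
  note check = assms[unfolded octagon_check_def Let_def list_all_iff list_ex_iff List.member_iff]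
  have "inj_on ?h (letters {..<8})"
    using check by (auto simp: distinct_map set_letter_list)
  moreover have "?h ` letters {..<8} \<subseteq> letters {..<8}"
    using check by (auto simp: set_letter_list)
  moreover have "finite (letters {..<8::nat})"
    by (simp add: letters_def)
  ultimately show "bij_betw ?h (letters (gens (cyclic_presentation 8 v))) (letters (gens (cyclic_presentation 8 w)))"
    unfolding gens bij_betw_def using endo_inj_surj by blast
  show "rels (cyclic_presentation 8 v) \<subseteq> carrier (free_group (gens (cyclic_presentation 8 v)))"
    "rels (cyclic_presentation 8 w) \<subseteq> carrier (free_group (gens (cyclic_presentation 8 w)))"
    unfolding gens set_relators[symmetric] using check by (auto simp: set_letter_list free_group_def)
  show "\<exists>q\<in>rels (cyclic_presentation 8 w). cyclically_equivalent q (map ?h r)"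
    if "r \<in> rels (cyclic_presentation 8 v)" for r
    using check that rotations unfolding set_relators[symmetric] by blast
  show "\<exists>r\<in>rels (cyclic_presentation 8 v). cyclically_equivalent (map ?h r) q"
    if "q \<in> rels (cyclic_presentation 8 w)" for q
    using check that rotations unfolding set_relators[symmetric] by blast
qed (rule signed_affine_letter_inv)

text \<open>The parameters need not be reduced mod 8, so multiples such as \<open>5 * a\<close> can
  be inserted directly.\<close>

definition octagon_word :: "nat \<Rightarrow> nat \<Rightarrow> nat \<Rightarrow> nat word" where
  "octagon_word a1 b1 a2 = [Gen 0, Inv (a1 mod 8), Gen ((a1 + b1) mod 8), Inv ((a1 + b1 + a2) mod 8)]"

text \<open>If a2 = 3 a1, then b2 = -4 a1 - b1 is 3 b1 for every odd b1, which gives the four cases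
  with a2 = 3 a1. If a2 = 5 a1, then b2 = 3 b1 is impossible and b2 = -3 b1 means b1 = 3 a1 mod 4,
  which gives the other two.\<close>

lemma octagon_arith:
  "list_all (\<lambda>a1. list_all (\<lambda>b1. list_all (\<lambda>a2.
     odd b1 \<and> ([int a2 = 3 * int a1] (mod 8) \<or> [int a2 = - 3 * int a1] (mod 8)) \<and>
       ([- (int a1 + int b1 + int a2) = 3 * int b1] (mod 8) \<or>
        [- (int a1 + int b1 + int a2) = - 3 * int b1] (mod 8)) \<longleftrightarrow>
     (([a2 = 5 * a1] (mod 8) \<and> [b1 = 3 * a1] (mod 8) \<or> [a2 = 5 * a1] (mod 8) \<and> [b1 = 7 * a1] (mod 8)) \<or>
      ([a2 = 3 * a1] (mod 8) \<and> [b1 = 5 * a1] (mod 8) \<or> [a2 = 3 * a1] (mod 8) \<and> [b1 = 7 * a1] (mod 8)) \<or>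
      ([a2 = 3 * a1] (mod 8) \<and> [b1 = a1] (mod 8) \<or> [a2 = 3 * a1] (mod 8) \<and> [b1 = 3 * a1] (mod 8))))
     [0..<8]) [0..<8]) [1, 3, 5, 7]"
  unfolding cong_def by code_simp

text \<open>
  As \<open>a * a = 1\<close> mod 8 for odd \<open>a\<close>, the factor \<open>a\<close> reduces to the case \<open>a1 = 1\<close>. The factor
  \<open>7 = -1\<close> reverses the order of the subscripts, and in the last two cases no relabelling that is
  affine on all of \<open>\<int>/8\<close> works: the odd subscripts are moved by \<open>2\<close> or \<open>-2\<close> relative to the even ones.
\<close>

lemma octagon_checks:
  "list_all (\<lambda>a.
     octagon_check (1 * a) 0 (octagon_word a (3 * a) (5 * a)) [Gen 0, Gen 1, Gen 4, Gen 1] \<and>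
     octagon_check (7 * a) 0 (octagon_word a (7 * a) (5 * a)) [Gen 0, Gen 1, Gen 4, Gen 1] \<and>
     octagon_check (1 * a) 0 (octagon_word a (5 * a) (3 * a)) [Gen 0, Gen 1, Gen 6, Gen 1] \<and>
     octagon_check (7 * a) 0 (octagon_word a (7 * a) (3 * a)) [Gen 0, Gen 1, Gen 6, Gen 1] \<and>
     octagon_check (1 * a) 2 (octagon_word a a (3 * a)) [Gen 0, Gen 1, Gen 4, Gen 3] \<and>
     octagon_check (1 * a) 6 (octagon_word a (3 * a) (3 * a)) [Gen 0, Gen 1, Gen 4, Gen 3])
   [1, 3, 5, 7]"
  by code_simp

lemma octagon_word_cong:
  assumes "[b = b'] (mod 8)" "[c = c'] (mod 8)"
  shows "octagon_word a b c = octagon_word a b' c'"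
  using cong_add[OF cong_refl[of a] assms(1)] cong_add[OF cong_add[OF cong_refl[of a] assms(1)] assms(2)]
  by (simp add: octagon_word_def cong_def)

theorem corollary6p2:
  fixes n \<nu> a1 b1 a2 :: nat
    and w :: "nat word"
    and P :: "nat presentation"
    and G :: "nat word set monoid"
  assumes "n \<ge> 1" and "\<nu> \<ge> 1"
    and "a1 < n" and "b1 < n" and "a2 < n"
    and "w = [Gen 0, Inv a1, Gen ((a1 + b1) mod n), Inv ((a1 + b1 + a2) mod n)]"
    and "cyclically_reduced w"
    and "P = cyclic_presentation n w"
    and "irreducible_cyclic n w"
    and "non_redundant P"
    and "G = presented_group P"
  shows
    "(special 2 4 \<nu> P \<longleftrightarrow>
        n = 8 \<and> \<nu> = 2 \<and>
        (([a2 = 5 * a1] (mod n) \<and> [b1 = 3 * a1] (mod n) \<or>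
          [a2 = 5 * a1] (mod n) \<and> [b1 = 7 * a1] (mod n)) \<or>
         ([a2 = 3 * a1] (mod n) \<and> [b1 = 5 * a1] (mod n) \<or>
          [a2 = 3 * a1] (mod n) \<and> [b1 = 7 * a1] (mod n)) \<or>
         ([a2 = 3 * a1] (mod n) \<and> [b1 = a1] (mod n) \<or>
          [a2 = 3 * a1] (mod n) \<and> [b1 = 3 * a1] (mod n)))) \<and>
     (n = 8 \<and> ([a2 = 5 * a1] (mod n) \<and> [b1 = 3 * a1] (mod n) \<or>
               [a2 = 5 * a1] (mod n) \<and> [b1 = 7 * a1] (mod n)) \<longrightarrow>
        G \<cong> cyclic_group 8 [Gen 0, Gen 1, Gen 4, Gen 1]) \<and>
     (n = 8 \<and> ([a2 = 3 * a1] (mod n) \<and> [b1 = 5 * a1] (mod n) \<or>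
               [a2 = 3 * a1] (mod n) \<and> [b1 = 7 * a1] (mod n)) \<longrightarrow>
        G \<cong> cyclic_group 8 [Gen 0, Gen 1, Gen 6, Gen 1]) \<and>
     (n = 8 \<and> ([a2 = 3 * a1] (mod n) \<and> [b1 = a1] (mod n) \<or>
               [a2 = 3 * a1] (mod n) \<and> [b1 = 3 * a1] (mod n)) \<longrightarrow>
        G \<cong> cyclic_group 8 [Gen 0, Gen 1, Gen 4, Gen 3])"
proof -
  define b2 where "b2 = - (int a1 + int b1 + int a2)"
  let ?a = "[a2 = 5 * a1] (mod n) \<and> [b1 = 3 * a1] (mod n) \<or> [a2 = 5 * a1] (mod n) \<and> [b1 = 7 * a1] (mod n)"
  let ?b = "[a2 = 3 * a1] (mod n) \<and> [b1 = 5 * a1] (mod n) \<or> [a2 = 3 * a1] (mod n) \<and> [b1 = 7 * a1] (mod n)"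
  let ?c = "[a2 = 3 * a1] (mod n) \<and> [b1 = a1] (mod n) \<or> [a2 = 3 * a1] (mod n) \<and> [b1 = 3 * a1] (mod n)"
  have "nat (int a1 mod int n) = a1" "nat ((int a1 + int b1) mod int n) = (a1 + b1) mod n"
    "nat ((int a1 + int b1 + int a2) mod int n) = (a1 + b1 + a2) mod n"
    using \<open>a1 < n\<close> by (simp_all flip: of_nat_add zmod_int)
  then have w: "w = alt_word n True 0 (int a1) (int b1) (int a2)"
    by (simp add: assms(6) alt_word_def sletter_def)
  interpret alternating n "int a1" "int b1" "int a2" b2 P
    using assms(1) rels_cyclic_presentation_alt_word[of n True "int a1" "int b1" "int a2"]
    by unfold_locales (simp_all add: b2_def \<open>P = _\<close> w, simp add: cyclic_presentation_def)
  \<comment> \<open>A common divisor of \<open>n\<close> and the three parameters divides the sums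
    reduced mod \<open>n\<close>, hence every subscript in \<open>w\<close>.\<close>
  have gcd1: "is_unit e" if "e dvd n" "e dvd a1" "e dvd b1" "e dvd a2" for e :: nat
  proof -
    have "e dvd Gcd (insert n (\<Union>a\<in>set w. set_letter a))"
      using that by (intro Gcd_greatest) (auto simp: assms(6) intro!: dvd_mod)
    then show ?thesis
      using assms(9) unfolding irreducible_cyclic_def by (simp only:)
  qed
  have "is_unit d" if "d dvd int n" "d dvd int a1" "d dvd int b1" "d dvd int a2" for d :: int
    using gcd1[of "nat \<bar>d\<bar>"] that by (simp add: nat_abs_dvd_iff flip: int_dvd_int_iff)
  note forward = special_imp[OF _ this]
  have arith: "odd b1 \<and> ([int a2 = 3 * int a1] (mod 8) \<or> [int a2 = - 3 * int a1] (mod 8)) \<and>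
      ([b2 = 3 * int b1] (mod 8) \<or> [b2 = - 3 * int b1] (mod 8)) \<longleftrightarrow> ?a \<or> ?b \<or> ?c"
    if n: "n = 8" and "odd a1"
  proof -
    have "a1 \<in> set [1, 3, 5, 7]" "b1 \<in> set [0..<8]" "a2 \<in> set [0..<8]"
      using assms(3-5) \<open>odd a1\<close> unfolding n by (auto elim!: oddE)
    then show ?thesis
      using octagon_arith unfolding list_all_iff b2_def n by blast
  qed
  \<comment> \<open>If \<open>a1\<close> were even, the congruences would make \<open>a2\<close> and
    \<open>b1\<close> even, and 2 would violate irreducibility.\<close>
  have odd_a1: "odd a1" if n: "n = 8" and abc: "?a \<or> ?b \<or> ?c"
  proof
    assume "even a1"
    have "even i" if "[i = k * a1] (mod n)" for i k
      using that \<open>even a1\<close> cong_dvd_modulus_nat[of i "k * a1" n 2] cong_dvd_iff[of i "k * a1" 2]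
      by (simp add: n)
    then have "even a2" "even b1"
      using abc by (metis mult_1)+
    then show False
      using gcd1[of 2] \<open>even a1\<close> n by simp
  qed
  have backward: "special 2 4 2 P" if n: "n = 8" and abc: "?a \<or> ?b \<or> ?c"
  proof -
    interpret alternating_octagon n "int a1" "int b1" "int a2" b2 P
      using arith[OF n odd_a1[OF n abc]] abc odd_a1[OF n abc] n by unfold_locales auto
    show ?thesis
      by (rule special)
  qed
  \<comment> \<open>The value of \<open>\<nu>\<close> is read off by applying the converse: both
    instances count the components of the same star graph.\<close>
  have "\<nu> = 2" if "special 2 4 \<nu> P" "special 2 4 2 P"
    using that by (simp add: special_def)
  moreover have "n = 8 \<and> (?a \<or> ?b \<or> ?c)" if "special 2 4 \<nu> P"
    using forward[OF that] arith by simp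
  ultimately have "special 2 4 \<nu> P \<longleftrightarrow> n = 8 \<and> \<nu> = 2 \<and> (?a \<or> ?b \<or> ?c)"
    using backward by blast
  moreover have iso: "G \<cong> cyclic_group 8 t"
    if "n = 8" "octagon_check u d (octagon_word a1 b c) t" "[a2 = c] (mod n)" "[b1 = b] (mod n)" for u d b c t
  proof -
    have "w = octagon_word a1 b1 a2"
      using assms(3) \<open>n = 8\<close> by (simp add: assms(6) octagon_word_def)
    also have "\<dots> = octagon_word a1 b c"
      using that by (intro octagon_word_cong) simp_all
    finally show ?thesis
      using octagon_check_iso[OF that(2)] by (simp add: \<open>G = _\<close> \<open>P = _\<close> cyclic_group_def \<open>n = 8\<close>)
  qed
  moreover have checks: "octagon_check (1 * a1) 0 (octagon_word a1 (3 * a1) (5 * a1)) [Gen 0, Gen 1, Gen 4, Gen 1]"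
    "octagon_check (7 * a1) 0 (octagon_word a1 (7 * a1) (5 * a1)) [Gen 0, Gen 1, Gen 4, Gen 1]"
    "octagon_check (1 * a1) 0 (octagon_word a1 (5 * a1) (3 * a1)) [Gen 0, Gen 1, Gen 6, Gen 1]"
    "octagon_check (7 * a1) 0 (octagon_word a1 (7 * a1) (3 * a1)) [Gen 0, Gen 1, Gen 6, Gen 1]"
    "octagon_check (1 * a1) 2 (octagon_word a1 a1 (3 * a1)) [Gen 0, Gen 1, Gen 4, Gen 3]"
    "octagon_check (1 * a1) 6 (octagon_word a1 (3 * a1) (3 * a1)) [Gen 0, Gen 1, Gen 4, Gen 3]"
    if n: "n = 8" and abc: "?a \<or> ?b \<or> ?c"
  proof -
    have "a1 \<in> set [1, 3, 5, 7]"
      using odd_a1[OF n abc] assms(3) unfolding n by (auto elim!: oddE)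
    then show "octagon_check (1 * a1) 0 (octagon_word a1 (3 * a1) (5 * a1)) [Gen 0, Gen 1, Gen 4, Gen 1]"
      "octagon_check (7 * a1) 0 (octagon_word a1 (7 * a1) (5 * a1)) [Gen 0, Gen 1, Gen 4, Gen 1]"
      "octagon_check (1 * a1) 0 (octagon_word a1 (5 * a1) (3 * a1)) [Gen 0, Gen 1, Gen 6, Gen 1]"
      "octagon_check (7 * a1) 0 (octagon_word a1 (7 * a1) (3 * a1)) [Gen 0, Gen 1, Gen 6, Gen 1]"
      "octagon_check (1 * a1) 2 (octagon_word a1 a1 (3 * a1)) [Gen 0, Gen 1, Gen 4, Gen 3]"
      "octagon_check (1 * a1) 6 (octagon_word a1 (3 * a1) (3 * a1)) [Gen 0, Gen 1, Gen 4, Gen 3]"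
      using octagon_checks unfolding list_all_iff by blast+
  qed
  ultimately show ?thesis
    by blast
qed

end
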